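(* Let $n$ be a natural number, let $P$ be a non-empty finite set of primes, and let $\mu$ be a probability measure on $\mathrm{FG}_n(P)$. Then $\mu$ has finite first moment with respect to word length, i.e. $\int_{\mathrm{FG}_n(P)}|f|_{n,P}\,d\mu(f)<\infty$, if and only if $\mu$ has finite first moment with respect to adelic length, i.e. $\int_{\mathrm{FG}_n(P)}\llbracket f\rrbracket_{n,a}\,d\mu(f)<\infty$.
   Context: For $1\le r\le s\le n$ and $q\in\mathbb{Q}$, $\theta_{rs}(q)$ is the $n\times n$ matrix equal to $q$ at entry $(r,s)$ and equal to the identity matrix at every other entry. $U=\{\theta_{rs}(1),\theta_{rs}(1)^{-1}:1\le r<s\le n\}$, $J_P=\{\theta_{rr}(p),\theta_{rr}(p)^{-1}:p\in P,1\le r\le n\}$, $K_P=U\cup J_P$, and $\mathrm{FG}_n(P)$ is the (countable, discrete) subgroup of $GL_n(\mathbb{Q})$ generated by $K_P$; $|f|_{n,P}$ is the word length of $f$ with respect to $K_P$. For a prime $p$ and $v\in\mathbb{Q}_p^n$ let $|v|_p=\max_i|v_i|_p$; for $v\in\mathbb{R}^n$ let $|v|_\infty=\sqrt{\sum_i|v_i|^2}$. For $f\in GL_n(\mathbb{Q})$ and $p$ a prime or $p=\infty$, $\|f\|_p=\sup_{|v|_p=1}|fv|_p$ (with $v\in\mathbb{Q}_p^n$, respectively $v\in\mathbb{R}^n$). With $\mathcal{P}$ the set of all primes together with $\infty$ and $\ln^+=\max(\ln,0)$, the adelic length of $f\in GL_n(\mathbb{Q})$ is $$\llbracket f\rrbracket_{n,a}=\sum_{p\in\mathcal{P}}\left(\ln^+\|f\|_p+\ln^+\|f^{-1}\|_p\right).$$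 *)

theory Defs
  imports
    "HOL-Probability.Probability"
    "HOL-Algebra.QuotRing"
    "HOL-Algebra.Generated_Groups"
    "HOL-Computational_Algebra.Primes"
    "Jordan_Normal_Form.Matrix"
begin

section \<open>The p-adic numbers\<close>

definition padic_abs :: "nat \<Rightarrow> rat \<Rightarrow> real" where
  "padic_abs p x =
     (if x = 0 then 0
      else case quotient_of x of (a, b) \<Rightarrow>
        real p powi (int (multiplicity (int p) b) - int (multiplicity (int p) a)))"

definition padic_Cauchy :: "nat \<Rightarrow> (nat \<Rightarrow> rat) \<Rightarrow> bool" where
  "padic_Cauchy p x \<longleftrightarrow> (\<forall>e>0. \<exists>N. \<forall>k\<ge>N. \<forall>l\<ge>N. padic_abs p (x k - x l) < e)"

definition padic_Cauchy_ring :: "nat \<Rightarrow> (nat \<Rightarrow> rat) ring" where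
  "padic_Cauchy_ring p =
     \<lparr>carrier = {x. padic_Cauchy p x},
      mult = (\<lambda>x y k. x k * y k), one = (\<lambda>k. 1),
      zero = (\<lambda>k. 0), add = (\<lambda>x y k. x k + y k)\<rparr>"

definition padic_null :: "nat \<Rightarrow> (nat \<Rightarrow> rat) set" where
  "padic_null p = {x. (\<lambda>k. padic_abs p (x k)) \<longlonglongrightarrow> 0}"

text \<open>
  The field of p-adic numbers is the completion of the rationals with respect to the p-adic
  absolute value, that is, the ring of Cauchy sequences modulo the ideal of null sequences.
  Its elements are cosets; the absolute value of a coset is the common limit of the absolute
  values along its representatives.
\<close>

definition Q_p :: "nat \<Rightarrow> (nat \<Rightarrow> rat) set ring" where
  "Q_p p = padic_Cauchy_ring p Quot padic_null p"

definition padic_of_rat :: "nat \<Rightarrow> rat \<Rightarrow> (nat \<Rightarrow> rat) set" where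
  "padic_of_rat p q = padic_null p +>\<^bsub>padic_Cauchy_ring p\<^esub> (\<lambda>k. q)"

definition padic_norm :: "nat \<Rightarrow> (nat \<Rightarrow> rat) set \<Rightarrow> real" where
  "padic_norm p X = (THE r. \<forall>x\<in>X. (\<lambda>k. padic_abs p (x k)) \<longlonglongrightarrow> r)"


lemma padic_abs_0 [simp]: "padic_abs p 0 = 0"
  by (simp add: padic_abs_def)

lemma padic_abs_fract:
  assumes p: "prime p" and a: "a \<noteq> 0" and b: "b \<noteq> 0"
  shows "padic_abs p (of_int a / of_int b) =
    real p powi (int (multiplicity (int p) b) - int (multiplicity (int p) a))"
proof -
  obtain c d where q: "quotient_of (of_int a / of_int b) = (c, d)" by fastforce
  have d: "d > 0" using q quotient_of_denom_pos by blast
  have eq: "of_int a / of_int b = (of_int c / of_int d :: rat)"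
    using q quotient_of_div by blast
  have "of_int (a * d) = (of_int (c * b) :: rat)"
    using eq b d by (simp add: field_simps)
  hence ad: "a * d = c * b" by (simp only: of_int_eq_iff)
  have c: "c \<noteq> 0" using ad a d by auto
  have pe: "prime_elem (int p)" using p by simp
  have "multiplicity (int p) a + multiplicity (int p) d =
        multiplicity (int p) c + multiplicity (int p) b"
    using arg_cong[OF ad, of "multiplicity (int p)"] pe a b c d
    by (simp add: prime_elem_multiplicity_mult_distrib)
  hence "int (multiplicity (int p) d) - int (multiplicity (int p) c) =
         int (multiplicity (int p) b) - int (multiplicity (int p) a)" by linarith
  thus ?thesis using a b by (simp add: padic_abs_def q)
qed

lemma padic_abs_pos: "prime p \<Longrightarrow> x \<noteq> 0 \<Longrightarrow> padic_abs p x > 0"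
  by (auto simp: padic_abs_def prime_gt_0_nat split: prod.splits)

lemma padic_abs_nonneg [simp]: "padic_abs p x \<ge> 0"
  by (auto simp: padic_abs_def split: prod.splits)

lemma padic_abs_mult:
  assumes p: "prime p"
  shows "padic_abs p (x * y) = padic_abs p x * padic_abs p y"
proof (cases "x = 0 \<or> y = 0")
  case False
  obtain a b where x: "x = of_int a / of_int b" "b \<noteq> 0"
    by (metis quotient_of_div quotient_of_denom_pos less_irrefl surj_pair)
  obtain c d where y: "y = of_int c / of_int d" "d \<noteq> 0"
    by (metis quotient_of_div quotient_of_denom_pos less_irrefl surj_pair)
  have ac: "a \<noteq> 0" "c \<noteq> 0" using False x y by auto
  have pe: "prime_elem (int p)" using p by simp
  have xy: "x * y = of_int (a * c) / of_int (b * d)" using x y by simp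
  have p0: "real p \<noteq> 0" using prime_gt_0_nat[OF p] by simp
  have bd: "a * c \<noteq> 0" "b * d \<noteq> 0" using ac x y by auto
  show ?thesis
    using p0 ac x(2) y(2) pe
    unfolding xy padic_abs_fract[OF p bd] unfolding x(1) y(1) padic_abs_fract[OF p ac(1) x(2)]
      padic_abs_fract[OF p ac(2) y(2)]
    by (simp add: prime_elem_multiplicity_mult_distrib algebra_simps flip: power_int_add)
qed auto

lemma padic_abs_1 [simp]: "prime p \<Longrightarrow> padic_abs p 1 = 1"
  using padic_abs_fract[of p 1 1] by simp

lemma padic_abs_minus: "prime p \<Longrightarrow> padic_abs p (- x) = padic_abs p x"
proof -
  assume p: "prime p"
  have "padic_abs p (-1) = 1" using padic_abs_fract[of p "-1" 1] p
    by (simp add: multiplicity_unit_right)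
  thus ?thesis using padic_abs_mult[OF p, of "-1" x] by simp
qed

lemma padic_abs_int_le_1:
  assumes p: "prime p" shows "padic_abs p (of_int a) \<le> 1"
proof (cases "a = 0")
  case False
  have "real p \<ge> 1" using prime_gt_0_nat[OF p] by simp
  hence "real p powi - int (multiplicity (int p) a) \<le> 1"
    by (simp add: power_int_minus inverse_le_1_iff)
  thus ?thesis using padic_abs_fract[OF p False, of 1] by simp
qed simp

lemma padic_abs_plus_one_le_1:
  assumes p: "prime p" and "x \<noteq> 0" "padic_abs p x \<le> 1"
  shows "padic_abs p (x + 1) \<le> 1"
proof -
  obtain a b where q: "quotient_of x = (a, b)" by fastforce
  have b: "b > 0" and cop: "coprime a b"
    using q quotient_of_denom_pos quotient_of_coprime by blast+
  have x: "x = of_int a / of_int b" using q quotient_of_div by blast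
  have a: "a \<noteq> 0" using x assms by auto
  have p1: "real p > 1" using prime_gt_1_nat[OF p] by simp
  have "multiplicity (int p) b \<le> multiplicity (int p) a"
  proof (rule ccontr)
    assume "\<not> ?thesis"
    hence "1 < real p powi (int (multiplicity (int p) b) - int (multiplicity (int p) a))"
      using p1 power_int_strict_increasing[of 0 _ "real p"] by simp
    thus False using assms(3) padic_abs_fract[OF p a, of b] b x by simp
  qed
  moreover have "multiplicity (int p) b = 0 \<or> multiplicity (int p) a = 0"
  proof (rule ccontr)
    assume "\<not> ?thesis"
    hence ab: "int p dvd a" "int p dvd b"
      by (metis not_dvd_imp_multiplicity_0)+
    have "is_unit (int p)" by (rule coprime_common_divisor[OF cop ab])
    thus False using p by auto
  qed
  ultimately have mb: "multiplicity (int p) b = 0" by linarith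
  hence "padic_abs p (of_int b) = 1" using padic_abs_fract[OF p, of b 1] b by simp
  moreover have "padic_abs p (x + 1) * padic_abs p (of_int b) \<le> 1"
    unfolding padic_abs_mult[OF p, symmetric]
    using padic_abs_int_le_1[OF p, of "a + b"] b x by (simp add: field_simps)
  ultimately show ?thesis by simp
qed

lemma padic_abs_add:
  assumes p: "prime p"
  shows "padic_abs p (x + y) \<le> max (padic_abs p x) (padic_abs p y)"
proof -
  have aux: "padic_abs p (x + y) \<le> padic_abs p y"
    if "padic_abs p x \<le> padic_abs p y" "x \<noteq> 0" "y \<noteq> 0" for x y
  proof -
    have "padic_abs p x = padic_abs p (x / y) * padic_abs p y"
      using that by (simp flip: padic_abs_mult[OF p])
    hence "padic_abs p (x / y) \<le> 1"
      using that padic_abs_pos[OF p, of y] by (simp add: field_simps)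
    hence "padic_abs p (x / y + 1) \<le> 1" using that by (intro padic_abs_plus_one_le_1 p) auto
    hence "padic_abs p (x / y + 1) * padic_abs p y \<le> padic_abs p y"
      by (simp add: mult_left_le_one_le)
    moreover have "(x / y + 1) * y = x + y" using that by (simp add: field_simps)
    ultimately show ?thesis by (simp flip: padic_abs_mult[OF p])
  qed
  show ?thesis
    using aux[of x y] aux[of y x] by (cases "x = 0"; cases "y = 0"; force simp: add.commute)
qed

lemma padic_abs_triangle:
  assumes p: "prime p"
  shows "padic_abs p (x + y) \<le> padic_abs p x + padic_abs p y"
  using padic_abs_add[OF p, of x y] padic_abs_nonneg[of p x] padic_abs_nonneg[of p y] by linarith

lemma padic_abs_diff_le:
  assumes p: "prime p"
  shows "\<bar>padic_abs p x - padic_abs p y\<bar> \<le> padic_abs p (x - y)"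
proof -
  have "padic_abs p x \<le> padic_abs p (x - y) + padic_abs p y" for x y
    using padic_abs_triangle[OF p, of "x - y" y] by simp
  from this[of x y] this[of y x] show ?thesis
    using padic_abs_minus[OF p, of "x - y"] by simp
qed

lemma padic_Cauchy_convergent:
  assumes p: "prime p" and "padic_Cauchy p x"
  shows "convergent (\<lambda>k. padic_abs p (x k))"
proof -
  have "Cauchy (\<lambda>k. padic_abs p (x k))"
    using assms(2) padic_abs_diff_le[OF p] unfolding padic_Cauchy_def Cauchy_def dist_real_def
    by (meson le_less_trans)
  thus ?thesis by (simp add: Cauchy_convergent_iff)
qed

lemma padic_Cauchy_bounded:
  assumes p: "prime p" and "padic_Cauchy p x"
  obtains B where "B > 0" "\<And>k. padic_abs p (x k) \<le> B"
  using convergent_imp_Bseq[OF padic_Cauchy_convergent[OF assms]]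
  by (auto simp: Bseq_def)

lemma padic_null_Cauchy:
  assumes p: "prime p" and "x \<in> padic_null p"
  shows "padic_Cauchy p x"
  unfolding padic_Cauchy_def
proof safe
  fix e :: real assume "e > 0"
  then obtain N where N: "\<And>k. k \<ge> N \<Longrightarrow> padic_abs p (x k) < e"
    using assms(2) by (force simp: padic_null_def lim_sequentially)
  have "padic_abs p (x k - x l) < e" if "k \<ge> N" "l \<ge> N" for k l
    using padic_abs_add[OF p, of "x k" "- x l"] N[OF that(1)] N[OF that(2)] padic_abs_minus[OF p]
    by (simp add: max_def split: if_splits)
  thus "\<exists>N. \<forall>k\<ge>N. \<forall>l\<ge>N. padic_abs p (x k - x l) < e" by blast
qed

lemma padic_Cauchy_add:
  assumes p: "prime p" and "padic_Cauchy p x" "padic_Cauchy p y"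
  shows "padic_Cauchy p (\<lambda>k. x k + y k)"
  unfolding padic_Cauchy_def
proof safe
  fix e :: real assume "e > 0"
  then obtain M N where M: "\<And>k l. k \<ge> M \<Longrightarrow> l \<ge> M \<Longrightarrow> padic_abs p (x k - x l) < e"
    and N: "\<And>k l. k \<ge> N \<Longrightarrow> l \<ge> N \<Longrightarrow> padic_abs p (y k - y l) < e"
    using assms unfolding padic_Cauchy_def by meson
  have "padic_abs p (x k + y k - (x l + y l)) < e" if "k \<ge> max M N" "l \<ge> max M N" for k l
    using padic_abs_add[OF p, of "x k - x l" "y k - y l"] M[of k l] N[of k l] that
    by (simp add: max_def algebra_simps split: if_splits)
  thus "\<exists>N. \<forall>k\<ge>N. \<forall>l\<ge>N. padic_abs p (x k + y k - (x l + y l)) < e" by blast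
qed

lemma padic_Cauchy_mult:
  assumes p: "prime p" and x: "padic_Cauchy p x" and y: "padic_Cauchy p y"
  shows "padic_Cauchy p (\<lambda>k. x k * y k)"
  unfolding padic_Cauchy_def
proof safe
  fix e :: real assume e: "e > 0"
  obtain A where A: "A > 0" "\<And>k. padic_abs p (x k) \<le> A" using padic_Cauchy_bounded[OF p x] by blast
  obtain B where B: "B > 0" "\<And>k. padic_abs p (y k) \<le> B" using padic_Cauchy_bounded[OF p y] by blast
  obtain M where M: "\<And>k l. k \<ge> M \<Longrightarrow> l \<ge> M \<Longrightarrow> padic_abs p (x k - x l) < e / B"
    using x e B unfolding padic_Cauchy_def by (meson divide_pos_pos)
  obtain N where N: "\<And>k l. k \<ge> N \<Longrightarrow> l \<ge> N \<Longrightarrow> padic_abs p (y k - y l) < e / A"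
    using y e A unfolding padic_Cauchy_def by (meson divide_pos_pos)
  have "padic_abs p (x k * y k - x l * y l) < e" if "k \<ge> max M N" "l \<ge> max M N" for k l
  proof -
    have "padic_abs p (x k * (y k - y l)) < e" "padic_abs p ((x k - x l) * y l) < e"
    proof -
      have "padic_abs p (x k * (y k - y l)) \<le> A * padic_abs p (y k - y l)"
        unfolding padic_abs_mult[OF p] by (intro mult_right_mono A) auto
      also have "\<dots> < A * (e / A)" using N that A by (intro mult_strict_left_mono) auto
      finally show "padic_abs p (x k * (y k - y l)) < e" using A by simp
      have "padic_abs p ((x k - x l) * y l) \<le> padic_abs p (x k - x l) * B"
        unfolding padic_abs_mult[OF p] by (intro mult_left_mono B) auto
      also have "\<dots> < (e / B) * B" using M that B by (intro mult_strict_right_mono) auto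
      finally show "padic_abs p ((x k - x l) * y l) < e" using B by simp
    qed
    thus ?thesis
      using padic_abs_add[OF p, of "x k * (y k - y l)" "(x k - x l) * y l"]
      by (simp add: max_def algebra_simps split: if_splits)
  qed
  thus "\<exists>N. \<forall>k\<ge>N. \<forall>l\<ge>N. padic_abs p (x k * y k - x l * y l) < e" by blast
qed

lemma padic_Cauchy_const: "padic_Cauchy p (\<lambda>k. c)"
  by (auto simp: padic_Cauchy_def)

lemma padic_Cauchy_minus:
  assumes "prime p" "padic_Cauchy p x"
  shows "padic_Cauchy p (\<lambda>k. - x k)"
  using padic_Cauchy_mult[OF assms(1) padic_Cauchy_const[of p "-1"] assms(2)] by simp

lemma cring_padic_Cauchy_ring:
  assumes p: "prime p"
  shows "cring (padic_Cauchy_ring p)"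
proof (rule cringI)
  show "abelian_group (padic_Cauchy_ring p)"
    by (rule abelian_groupI)
      (auto simp: padic_Cauchy_ring_def padic_Cauchy_const algebra_simps padic_Cauchy_add[OF p]
         intro!: bexI[of _ "\<lambda>k. - _ k"] padic_Cauchy_minus[OF p])
  show "comm_monoid (padic_Cauchy_ring p)"
    by (rule comm_monoidI)
      (auto simp: padic_Cauchy_ring_def padic_Cauchy_const padic_Cauchy_mult[OF p] algebra_simps)
qed (auto simp: padic_Cauchy_ring_def algebra_simps)

lemma padic_null_add:
  assumes p: "prime p" and "x \<in> padic_null p" "y \<in> padic_null p"
  shows "(\<lambda>k. x k + y k) \<in> padic_null p"
proof -
  have lim: "(\<lambda>k. padic_abs p (x k) + padic_abs p (y k)) \<longlonglongrightarrow> 0"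
    using tendsto_add[of "\<lambda>k. padic_abs p (x k)" 0 sequentially "\<lambda>k. padic_abs p (y k)" 0] assms
    by (simp add: padic_null_def)
  have "(\<lambda>k. padic_abs p (x k + y k)) \<longlonglongrightarrow> 0"
    by (rule Lim_null_comparison[OF _ lim]) (simp add: padic_abs_triangle[OF p])
  thus ?thesis by (simp add: padic_null_def)
qed

lemma padic_null_mult:
  assumes p: "prime p" and x: "padic_Cauchy p x" and y: "y \<in> padic_null p"
  shows "(\<lambda>k. x k * y k) \<in> padic_null p"
proof -
  obtain l where "(\<lambda>k. padic_abs p (x k)) \<longlonglongrightarrow> l"
    using padic_Cauchy_convergent[OF p x] by (auto simp: convergent_def)
  from tendsto_mult[OF this, of "\<lambda>k. padic_abs p (y k)" 0] y show ?thesis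
    by (simp add: padic_null_def padic_abs_mult[OF p])
qed

lemma ideal_padic_null:
  assumes p: "prime p"
  shows "ideal (padic_null p) (padic_Cauchy_ring p)"
proof -
  interpret cring "padic_Cauchy_ring p" by (rule cring_padic_Cauchy_ring[OF p])
  have minus: "\<ominus>\<^bsub>padic_Cauchy_ring p\<^esub> x = (\<lambda>k. - x k)" if "padic_Cauchy p x" for x
    using that padic_Cauchy_minus[OF p that]
    by (intro minus_equality) (auto simp: padic_Cauchy_ring_def)
  show ?thesis
  proof (rule idealI)
    show "ring (padic_Cauchy_ring p)" by (rule ring_axioms)
    show "subgroup (padic_null p) (add_monoid (padic_Cauchy_ring p))"
    proof (rule add.subgroupI)
      show "padic_null p \<subseteq> carrier (padic_Cauchy_ring p)"
        using padic_null_Cauchy[OF p] by (auto simp: padic_Cauchy_ring_def)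
      show "padic_null p \<noteq> {}"
        by (auto simp: padic_null_def intro!: exI[of _ "\<lambda>k. 0"])
      show "\<ominus>\<^bsub>padic_Cauchy_ring p\<^esub> x \<in> padic_null p" if "x \<in> padic_null p" for x
        using that padic_null_Cauchy[OF p that] minus[of x]
        by (auto simp: padic_null_def padic_abs_minus[OF p])
      show "x \<oplus>\<^bsub>padic_Cauchy_ring p\<^esub> y \<in> padic_null p"
        if "x \<in> padic_null p" "y \<in> padic_null p" for x y
        using padic_null_add[OF p that] by (simp add: padic_Cauchy_ring_def)
    qed
      fix a x assume a: "a \<in> padic_null p" and x: "x \<in> carrier (padic_Cauchy_ring p)"
    have "(\<lambda>k. x k * a k) \<in> padic_null p"
      using x by (intro padic_null_mult[OF p _ a]) (simp add: padic_Cauchy_ring_def)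
    thus "x \<otimes>\<^bsub>padic_Cauchy_ring p\<^esub> a \<in> padic_null p" "a \<otimes>\<^bsub>padic_Cauchy_ring p\<^esub> x \<in> padic_null p"
      by (simp_all add: padic_Cauchy_ring_def mult.commute)
  qed
qed

lemma cring_Q_p: "prime p \<Longrightarrow> cring (Q_p p)"
  unfolding Q_p_def
  by (intro ideal.quotient_is_cring ideal_padic_null cring_padic_Cauchy_ring)

lemma padic_coset_def:
  "padic_null p +>\<^bsub>padic_Cauchy_ring p\<^esub> x = {y. \<exists>z\<in>padic_null p. y = (\<lambda>k. z k + x k)}"
  by (auto simp: a_r_coset_def' padic_Cauchy_ring_def)

lemma carrier_Q_p:
  "carrier (Q_p p) = {padic_null p +>\<^bsub>padic_Cauchy_ring p\<^esub> x | x. padic_Cauchy p x}"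
  by (auto simp: Q_p_def FactRing_def A_RCOSETS_def' padic_Cauchy_ring_def)

lemma padic_norm_coset:
  assumes p: "prime p" and x: "padic_Cauchy p x"
  shows "(\<lambda>k. padic_abs p (x k)) \<longlonglongrightarrow>
           padic_norm p (padic_null p +>\<^bsub>padic_Cauchy_ring p\<^esub> x)" (is "_ \<longlonglongrightarrow> padic_norm p ?X")
proof -
  obtain l where l: "(\<lambda>k. padic_abs p (x k)) \<longlonglongrightarrow> l"
    using padic_Cauchy_convergent[OF p x] by (auto simp: convergent_def)
  have all: "(\<lambda>k. padic_abs p (y k)) \<longlonglongrightarrow> l" if y: "y \<in> ?X" for y
  proof -
    obtain z where z: "z \<in> padic_null p" "y = (\<lambda>k. z k + x k)"
      using y by (auto simp: padic_coset_def)
    have "(\<lambda>k. padic_abs p (y k) - padic_abs p (x k)) \<longlonglongrightarrow> 0"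
    proof (rule Lim_null_comparison)
      show "\<forall>\<^sub>F k in sequentially. norm (padic_abs p (y k) - padic_abs p (x k)) \<le> padic_abs p (z k)"
        using padic_abs_diff_le[OF p, of "z k + x k" "x k" for k] z by simp
    qed (use z in \<open>simp add: padic_null_def\<close>)
    from tendsto_add[OF this l] show ?thesis by simp
  qed
  have mem: "x \<in> ?X"
    unfolding padic_coset_def mem_Collect_eq
    by (rule bexI[of _ "\<lambda>k. 0"]) (auto simp: padic_null_def)
  have "padic_norm p ?X = l"
    unfolding padic_norm_def using all mem by (intro the_equality) (auto intro: LIMSEQ_unique)
  thus ?thesis using l by simp
qed

lemma padic_norm_of_rat: "prime p \<Longrightarrow> padic_norm p (padic_of_rat p q) = padic_abs p q"
  using padic_norm_coset[OF _ padic_Cauchy_const, of p q]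
  by (simp add: padic_of_rat_def LIMSEQ_const_iff)


lemma field_Q_p:
  assumes p: "prime p"
  shows "field (Q_p p)"
proof -
  let ?R = "padic_Cauchy_ring p" and ?I = "padic_null p"
  interpret R: cring ?R by (rule cring_padic_Cauchy_ring[OF p])
  interpret I: ideal ?I ?R by (rule ideal_padic_null[OF p])
  have "maximalideal ?I ?R"
  proof (rule maximalidealI)
    have "(\<lambda>k. 1) \<notin> ?I" using p by (simp add: padic_null_def LIMSEQ_const_iff)
    moreover have "(\<lambda>k. 1) \<in> carrier ?R" by (simp add: padic_Cauchy_ring_def padic_Cauchy_const)
    ultimately show "carrier ?R \<noteq> ?I" by metis
    fix J assume J: "ideal J ?R" "?I \<subseteq> J" "J \<subseteq> carrier ?R"
    interpret J: ideal J ?R by fact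
    show "J = ?I \<or> J = carrier ?R"
    proof (rule disjCI)
      assume "J \<noteq> carrier ?R"
      have "x \<in> ?I" if xJ: "x \<in> J" for x
      proof (rule ccontr)
        assume nx: "x \<notin> ?I"
        have x: "padic_Cauchy p x" using xJ J(3) by (auto simp: padic_Cauchy_ring_def)
        obtain l where l: "(\<lambda>k. padic_abs p (x k)) \<longlonglongrightarrow> l"
          using padic_Cauchy_convergent[OF p x] by (auto simp: convergent_def)
        have "l \<ge> 0" by (rule LIMSEQ_le_const[OF l]) auto
        moreover have "l \<noteq> 0" using nx l by (auto simp: padic_null_def)
        ultimately have l0: "l > 0" by simp
        hence "eventually (\<lambda>k. padic_abs p (x k) > l / 2) sequentially"
          by (intro order_tendstoD(1)[OF l]) simp
        then obtain M where M: "\<And>k. k \<ge> M \<Longrightarrow> padic_abs p (x k) > l / 2"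
          by (auto simp: eventually_sequentially)
        have nz: "x k \<noteq> 0" if "k \<ge> M" for k using M[OF that] l0 by auto
        define y where "y k = inverse (x k)" for k
        have y: "padic_Cauchy p y"
          unfolding padic_Cauchy_def
        proof safe
          fix e :: real assume e: "e > 0"
          obtain N where N: "\<And>k l'. k \<ge> N \<Longrightarrow> l' \<ge> N \<Longrightarrow> padic_abs p (x k - x l') < e * (l / 2 * (l / 2))"
            using x e l0 unfolding padic_Cauchy_def
            by (metis half_gt_zero mult_pos_pos)
          have "padic_abs p (y i - y j) < e" if "i \<ge> max M N" "j \<ge> max M N" for i j
          proof (rule ccontr)
            assume "\<not> ?thesis"
            hence "e * (l / 2 * (l / 2)) \<le> padic_abs p (y i - y j) * (padic_abs p (x i) * padic_abs p (x j))"
              using M[of i] M[of j] that l0 e by (intro mult_mono) auto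
            also have "\<dots> = padic_abs p (x j - x i)"
            proof -
              have "(y i - y j) * (x i * x j) = x j - x i"
                using nz[of i] nz[of j] that by (simp add: y_def field_simps)
              thus ?thesis by (simp flip: padic_abs_mult[OF p])
            qed
            also have "\<dots> < e * (l / 2 * (l / 2))" using that by (intro N) auto
            finally show False by simp
          qed
          thus "\<exists>N. \<forall>k\<ge>N. \<forall>l\<ge>N. padic_abs p (y k - y l) < e" by blast
        qed
        have "eventually (\<lambda>k. padic_abs p (1 - y k * x k) = 0) sequentially"
          using nz by (auto simp: eventually_sequentially y_def intro!: exI[of _ M])
        hence z: "(\<lambda>k. 1 - y k * x k) \<in> J"
          using J(2) by (auto simp: padic_null_def intro: tendsto_eventually)
        have "(\<lambda>k. y k * x k) \<in> J"
          using J.I_l_closed[OF xJ, of y] y by (simp add: padic_Cauchy_ring_def)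
        from additive_subgroup.a_closed[OF J.additive_subgroup_axioms this z]
        have "\<one>\<^bsub>?R\<^esub> \<in> J" by (simp add: padic_Cauchy_ring_def)
        thus False using J.one_imp_carrier \<open>J \<noteq> carrier ?R\<close> by simp
      qed
      thus "J = ?I" using J(2) by blast
    qed
  qed (rule I.is_ideal)
  thus ?thesis unfolding Q_p_def
    by (rule maximalideal.quotient_is_field) (rule R.cring_axioms)
qed


section \<open>Operator norms and adelic length\<close>

datatype place = Finite_Place nat | Infinite_Place

definition places :: "place set" where
  "places = insert Infinite_Place (Finite_Place ` {p. prime p})"

definition GL :: "nat \<Rightarrow> rat mat monoid" where
  "GL n = units_of (ring_mat TYPE(rat) n ())"

definition padic_vec_norm :: "nat \<Rightarrow> nat \<Rightarrow> (nat \<Rightarrow> rat) set vec \<Rightarrow> real" where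
  "padic_vec_norm n p v = Max ((\<lambda>i. padic_norm p (v $ i)) ` {..<n})"

definition padic_mult_mat_vec ::
    "nat \<Rightarrow> nat \<Rightarrow> rat mat \<Rightarrow> (nat \<Rightarrow> rat) set vec \<Rightarrow> (nat \<Rightarrow> rat) set vec" where
  "padic_mult_mat_vec n p f v =
     vec n (\<lambda>i. \<Oplus>\<^bsub>Q_p p\<^esub>j\<in>{..<n}. padic_of_rat p (f $$ (i, j)) \<otimes>\<^bsub>Q_p p\<^esub> v $ j)"

definition real_vec_norm :: "nat \<Rightarrow> real vec \<Rightarrow> real" where
  "real_vec_norm n v = sqrt (\<Sum>i<n. \<bar>v $ i\<bar>\<^sup>2)"

text \<open>
  Suprema and the sum over all places are taken in the extended nonnegative reals, where they
  always exist. In particular, the empty supremum, which occurs for n = 0, is 0.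
\<close>

fun op_norm :: "nat \<Rightarrow> place \<Rightarrow> rat mat \<Rightarrow> ennreal" where
  "op_norm n (Finite_Place p) f =
     (SUP v \<in> {v \<in> carrier_vec n. (\<forall>i<n. v $ i \<in> carrier (Q_p p)) \<and> padic_vec_norm n p v = 1}.
        ennreal (padic_vec_norm n p (padic_mult_mat_vec n p f v)))"
| "op_norm n Infinite_Place f =
     (SUP v \<in> {v \<in> carrier_vec n. real_vec_norm n v = 1}.
        ennreal (real_vec_norm n (map_mat real_of_rat f *\<^sub>v v)))"

definition ln_plus :: "ennreal \<Rightarrow> ennreal" where
  "ln_plus x = (if x = \<top> then \<top> else ennreal (max (ln (enn2real x)) 0))"

definition adelic_length :: "nat \<Rightarrow> rat mat \<Rightarrow> ennreal" where
  "adelic_length n f =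
     (\<Sum>\<^sub>\<infinity>p\<in>places. ln_plus (op_norm n p f) + ln_plus (op_norm n p (inv\<^bsub>GL n\<^esub> f)))"


section \<open>The groups FG and word length\<close>

text \<open>Rows and columns are numbered from 0 to n - 1.\<close>

definition theta :: "nat \<Rightarrow> nat \<Rightarrow> nat \<Rightarrow> rat \<Rightarrow> rat mat" where
  "theta n r s q = mat n n (\<lambda>(i, j). if i = r \<and> j = s then q else if i = j then 1 else 0)"

definition U_gens :: "nat \<Rightarrow> rat mat set" where
  "U_gens n = (\<Union>s<n. \<Union>r<s. {theta n r s 1, inv\<^bsub>GL n\<^esub> (theta n r s 1)})"

definition J_gens :: "nat \<Rightarrow> nat set \<Rightarrow> rat mat set" where
  "J_gens n P = (\<Union>p\<in>P. \<Union>r<n. {theta n r r (of_nat p), inv\<^bsub>GL n\<^esub> (theta n r r (of_nat p))})"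

definition K_gens :: "nat \<Rightarrow> nat set \<Rightarrow> rat mat set" where
  "K_gens n P = U_gens n \<union> J_gens n P"

definition FG :: "nat \<Rightarrow> nat set \<Rightarrow> rat mat set" where
  "FG n P = generate (GL n) (K_gens n P)"

definition word_length :: "nat \<Rightarrow> nat set \<Rightarrow> rat mat \<Rightarrow> nat" where
  "word_length n P f =
     (LEAST k. \<exists>ws. length ws = k \<and> set ws \<subseteq> K_gens n P \<and>
        foldr (\<otimes>\<^bsub>GL n\<^esub>) ws \<one>\<^bsub>GL n\<^esub> = f)"

lemma group_GL: "group (GL n)"
  unfolding GL_def
  by (intro monoid.units_group semiring.axioms(2) semiring_mat)

end

theory Submission
  imports Defs
begin

text \<open>
  Every \<open>f\<close> in the group is upper triangular, with entries that are integral outside \<open>P\<close>, so only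
  the places in \<open>P \<union> {\<infinity>}\<close> contribute to the adelic length, and each \<open>\<parallel>f\<parallel>\<^sub>v\<close> is, up to a constant,
  the maximal absolute value of an entry at \<open>v\<close>. A product of \<open>k\<close> generators has entries of
  size at most exponential in \<open>k\<close> at every place, so the adelic length is at most
  \<open>C (1 + |f|)\<close>. Conversely, reading off the columns writes \<open>f\<close> as a product of at most \<open>n\<^sup>2\<close>
  matrices \<open>\<theta>\<^bsub>rs\<^esub>(f\<^bsub>rs\<^esub>)\<close>, each of word length logarithmic in the numerator and the denominator of
  \<open>f\<^bsub>rs\<^esub>\<close>, and these logarithms are bounded by the adelic length. As \<open>\<mu>\<close> has total mass 1, additive
  constants do not affect finiteness of the moments.
\<close>

section \<open>Operator norms and matrix entries\<close>

lemma padic_norm_repr: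
  assumes "prime p" "X \<in> carrier (Q_p p)"
  obtains x where "padic_Cauchy p x" "X = padic_null p +>\<^bsub>padic_Cauchy_ring p\<^esub> x"
    "(\<lambda>k. padic_abs p (x k)) \<longlonglongrightarrow> padic_norm p X"
  using assms padic_norm_coset by (auto simp: carrier_Q_p)

text \<open>The ultrametric inequality for rationals passes to the limit: sums of representatives
  represent the sum of the cosets, and their absolute values converge to its norm.\<close>

lemma padic_norm_add_le:
  assumes p: "prime p" and X: "X \<in> carrier (Q_p p)" and Y: "Y \<in> carrier (Q_p p)"
  shows "padic_norm p (X \<oplus>\<^bsub>Q_p p\<^esub> Y) \<le> max (padic_norm p X) (padic_norm p Y)"
proof -
  interpret I: ideal "padic_null p" "padic_Cauchy_ring p" by (rule ideal_padic_null[OF p])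
  obtain x where x: "padic_Cauchy p x" "X = padic_null p +>\<^bsub>padic_Cauchy_ring p\<^esub> x"
    "(\<lambda>k. padic_abs p (x k)) \<longlonglongrightarrow> padic_norm p X" using padic_norm_repr[OF p X] .
  obtain y where y: "padic_Cauchy p y" "Y = padic_null p +>\<^bsub>padic_Cauchy_ring p\<^esub> y"
    "(\<lambda>k. padic_abs p (y k)) \<longlonglongrightarrow> padic_norm p Y" using padic_norm_repr[OF p Y] .
  have "X \<oplus>\<^bsub>Q_p p\<^esub> Y = padic_null p +>\<^bsub>padic_Cauchy_ring p\<^esub> (\<lambda>k. x k + y k)"
    using x(1) y(1) I.a_rcos_sum[of x y]
    by (simp add: Q_p_def FactRing_def x(2) y(2)) (simp add: padic_Cauchy_ring_def)
  then have "(\<lambda>k. padic_abs p (x k + y k)) \<longlonglongrightarrow> padic_norm p (X \<oplus>\<^bsub>Q_p p\<^esub> Y)"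
    using padic_norm_coset[OF p padic_Cauchy_add[OF p x(1) y(1)]] by simp
  then show ?thesis
    by (rule LIMSEQ_le[OF _ tendsto_max[OF x(3) y(3)]]) (use padic_abs_add[OF p] in blast)
qed

lemma padic_norm_mult:
  assumes p: "prime p" and X: "X \<in> carrier (Q_p p)" and Y: "Y \<in> carrier (Q_p p)"
  shows "padic_norm p (X \<otimes>\<^bsub>Q_p p\<^esub> Y) = padic_norm p X * padic_norm p Y"
proof -
  interpret I: ideal "padic_null p" "padic_Cauchy_ring p" by (rule ideal_padic_null[OF p])
  obtain x where x: "padic_Cauchy p x" "X = padic_null p +>\<^bsub>padic_Cauchy_ring p\<^esub> x"
    "(\<lambda>k. padic_abs p (x k)) \<longlonglongrightarrow> padic_norm p X" using padic_norm_repr[OF p X] .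
  obtain y where y: "padic_Cauchy p y" "Y = padic_null p +>\<^bsub>padic_Cauchy_ring p\<^esub> y"
    "(\<lambda>k. padic_abs p (y k)) \<longlonglongrightarrow> padic_norm p Y" using padic_norm_repr[OF p Y] .
  have "X \<otimes>\<^bsub>Q_p p\<^esub> Y = padic_null p +>\<^bsub>padic_Cauchy_ring p\<^esub> (\<lambda>k. x k * y k)"
    using x(1) y(1) I.rcoset_mult_add[of x y]
    by (simp add: Q_p_def FactRing_def x(2) y(2)) (simp add: padic_Cauchy_ring_def)
  then have "(\<lambda>k. padic_abs p (x k) * padic_abs p (y k)) \<longlonglongrightarrow> padic_norm p (X \<otimes>\<^bsub>Q_p p\<^esub> Y)"
    using padic_norm_coset[OF p padic_Cauchy_mult[OF p x(1) y(1)]] by (simp add: padic_abs_mult[OF p])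
  then show ?thesis using tendsto_mult[OF x(3) y(3)] LIMSEQ_unique by blast
qed

lemma padic_norm_nonneg:
  assumes p: "prime p" and X: "X \<in> carrier (Q_p p)"
  shows "0 \<le> padic_norm p X"
proof -
  obtain x where "(\<lambda>k. padic_abs p (x k)) \<longlonglongrightarrow> padic_norm p X" using padic_norm_repr[OF p X] .
  then show ?thesis by (rule LIMSEQ_le_const) auto
qed

lemma zero_Q_p: "\<zero>\<^bsub>Q_p p\<^esub> = padic_of_rat p 0"
  by (simp add: padic_of_rat_def padic_coset_def Q_p_def FactRing_def)

lemma one_Q_p: "\<one>\<^bsub>Q_p p\<^esub> = padic_of_rat p 1"
  by (simp add: padic_of_rat_def Q_p_def FactRing_def padic_Cauchy_ring_def)

lemma padic_of_rat_closed: "padic_of_rat p q \<in> carrier (Q_p p)"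
  using padic_Cauchy_const by (auto simp: carrier_Q_p padic_of_rat_def)

lemma padic_norm_finsum_le:
  assumes p: "prime p" and c: "c \<ge> 0" and "finite A"
    and "\<And>i. i \<in> A \<Longrightarrow> g i \<in> carrier (Q_p p)" "\<And>i. i \<in> A \<Longrightarrow> padic_norm p (g i) \<le> c"
  shows "padic_norm p (\<Oplus>\<^bsub>Q_p p\<^esub>i\<in>A. g i) \<le> c"
proof -
  interpret cring "Q_p p" by (rule cring_Q_p[OF p])
  show ?thesis
    using assms(3-)
  proof (induction A)
    case empty
    then show ?case using c by (simp add: zero_Q_p padic_norm_of_rat[OF p])
  next
    case (insert i A)
    have "padic_norm p (g i \<oplus>\<^bsub>Q_p p\<^esub> (\<Oplus>\<^bsub>Q_p p\<^esub>i\<in>A. g i)) \<le> c"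
      using insert by (intro order.trans[OF padic_norm_add_le[OF p]]) (auto intro!: finsum_closed)
    then show ?case using insert by (subst finsum_insert) auto
  qed
qed

text \<open>The ultrametric inequality bounds each coordinate of the image by the largest summand,
  so no factor depending on \<open>n\<close> appears, unlike at the infinite place.\<close>

lemma op_norm_finite_place_le:
  assumes p: "prime p" and c: "c \<ge> 1"
    and f: "\<And>i j. i < n \<Longrightarrow> j < n \<Longrightarrow> padic_abs p (f $$ (i, j)) \<le> c"
  shows "op_norm n (Finite_Place p) f \<le> ennreal c"
  unfolding op_norm.simps
proof (rule SUP_least)
  interpret cring "Q_p p" by (rule cring_Q_p[OF p])
  fix v assume v: "v \<in> {v \<in> carrier_vec n. (\<forall>i<n. v $ i \<in> carrier (Q_p p)) \<and> padic_vec_norm n p v = 1}"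
  have "padic_vec_norm n p (padic_mult_mat_vec n p f v) \<le> c"
  proof (cases "n = 0")
    \<comment> \<open>For \<open>n = 0\<close> the vector norm is the unspecified maximum of the
      empty set, the same value for \<open>v\<close> and its image. The constraint on
      \<open>v\<close> makes it 1, and \<open>c\<close> is at least 1.\<close>
    case True
    then show ?thesis using v c by (simp add: padic_vec_norm_def)
  next
    case False
    have v1: "padic_norm p (v $ j) \<le> 1" if "j < n" for j
    proof -
      have "padic_norm p (v $ j) \<le> padic_vec_norm n p v"
        unfolding padic_vec_norm_def using that by (intro Max_ge) auto
      then show ?thesis using v by simp
    qed
    have "padic_norm p (padic_of_rat p (f $$ (i, j)) \<otimes>\<^bsub>Q_p p\<^esub> v $ j) \<le> c"
      if "i < n" "j < n" for i j
    proof -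
      have "padic_abs p (f $$ (i, j)) * padic_norm p (v $ j) \<le> c * 1"
        using that v c by (intro mult_mono f v1 padic_norm_nonneg[OF p]) auto
      then show ?thesis
        using v that padic_of_rat_closed by (simp add: padic_norm_mult[OF p] padic_norm_of_rat[OF p])
    qed
    then have "padic_norm p (padic_mult_mat_vec n p f v $ i) \<le> c" if "i < n" for i
      using that v c padic_of_rat_closed
      by (auto simp: padic_mult_mat_vec_def intro!: padic_norm_finsum_le[OF p])
    then show ?thesis unfolding padic_vec_norm_def using False by (subst Max_le_iff) auto
  qed
  then show "ennreal (padic_vec_norm n p (padic_mult_mat_vec n p f v)) \<le> ennreal c"
    by (rule ennreal_leI)
qed

text \<open>The \<open>j\<close>-th standard basis vector has norm 1, and its image is the
  \<open>j\<close>-th column of \<open>f\<close>, whose norm dominates each of its entries.\<close>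

lemma padic_abs_le_op_norm:
  assumes p: "prime p" and "i < n" "j < n"
  shows "ennreal (padic_abs p (f $$ (i, j))) \<le> op_norm n (Finite_Place p) f"
proof -
  interpret cring "Q_p p" by (rule cring_Q_p[OF p])
  define v where "v = vec n (\<lambda>k. if k = j then \<one>\<^bsub>Q_p p\<^esub> else \<zero>\<^bsub>Q_p p\<^esub>)"
  have v: "v \<in> carrier_vec n" "\<And>i. i < n \<Longrightarrow> v $ i \<in> carrier (Q_p p)"
    by (auto simp: v_def)
  have "padic_norm p (v $ k) = (if k = j then 1 else 0)" if "k < n" for k
    using that by (simp add: v_def zero_Q_p one_Q_p padic_norm_of_rat[OF p] p)
  then have "padic_vec_norm n p v = 1"
    unfolding padic_vec_norm_def using assms by (intro Max_eqI) (auto intro!: image_eqI[of _ _ j])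
  with v have "ennreal (padic_vec_norm n p (padic_mult_mat_vec n p f v)) \<le> op_norm n (Finite_Place p) f"
    by (auto intro!: SUP_upper2)
  moreover have "padic_mult_mat_vec n p f v $ i = padic_of_rat p (f $$ (i, j))"
  proof -
    have "(\<Oplus>\<^bsub>Q_p p\<^esub>k\<in>{..<n}. padic_of_rat p (f $$ (i, k)) \<otimes>\<^bsub>Q_p p\<^esub> v $ k) =
      (\<Oplus>\<^bsub>Q_p p\<^esub>k\<in>{..<n}. if j = k then padic_of_rat p (f $$ (i, k)) else \<zero>\<^bsub>Q_p p\<^esub>)"
      using padic_of_rat_closed by (intro finsum_cong') (auto simp: v_def)
    also have "\<dots> = padic_of_rat p (f $$ (i, j))"
      using assms padic_of_rat_closed by (intro add.finprod_singleton[simplified]) auto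
    finally show ?thesis using assms by (simp add: padic_mult_mat_vec_def)
  qed
  moreover have "padic_norm p (padic_mult_mat_vec n p f v $ i) \<le> padic_vec_norm n p (padic_mult_mat_vec n p f v)"
    unfolding padic_vec_norm_def using assms by (intro Max_ge) auto
  ultimately show ?thesis
    using padic_norm_of_rat[OF p] by (metis ennreal_leI order.trans)
qed

text \<open>A crude bound suffices: one factor \<open>n\<close> comes from the sum over a row, the
  other from estimating the Euclidean norm by the sum of the absolute coordinates.\<close>

lemma op_norm_infinite_place_le:
  assumes f: "f \<in> carrier_mat n n" and c: "c \<ge> 0"
    and le: "\<And>i j. i < n \<Longrightarrow> j < n \<Longrightarrow> \<bar>real_of_rat (f $$ (i, j))\<bar> \<le> c"
  shows "op_norm n Infinite_Place f \<le> ennreal (real n * (real n * c))"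
  unfolding op_norm.simps
proof (intro SUP_least ennreal_leI)
  fix v assume v: "v \<in> {v \<in> carrier_vec n. real_vec_norm n v = 1}"
  have v1: "\<bar>v $ j\<bar> \<le> 1" if "j < n" for j
  proof -
    have "sqrt (\<bar>v $ j\<bar>\<^sup>2) \<le> real_vec_norm n v"
      unfolding real_vec_norm_def using that by (intro real_sqrt_le_mono member_le_sum) auto
    then show ?thesis using v by simp
  qed
  have row: "\<bar>(map_mat real_of_rat f *\<^sub>v v) $ i\<bar> \<le> real n * c" if "i < n" for i
  proof -
    have "\<bar>(map_mat real_of_rat f *\<^sub>v v) $ i\<bar> = \<bar>\<Sum>j<n. real_of_rat (f $$ (i, j)) * v $ j\<bar>"
      using that f v by (auto simp: scalar_prod_def lessThan_atLeast0 intro!: arg_cong[of _ _ abs] sum.cong)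
    also have "\<dots> \<le> (\<Sum>j<n. \<bar>real_of_rat (f $$ (i, j))\<bar> * \<bar>v $ j\<bar>)"
      using sum_abs[of "\<lambda>j. real_of_rat (f $$ (i, j)) * v $ j" "{..<n}"] by (simp add: abs_mult)
    also have "\<dots> \<le> (\<Sum>j<n. c * 1)"
      using that c by (intro sum_mono mult_mono le v1) auto
    finally show ?thesis by simp
  qed
  have "real_vec_norm n (map_mat real_of_rat f *\<^sub>v v) \<le> (\<Sum>i<n. \<bar>(map_mat real_of_rat f *\<^sub>v v) $ i\<bar>)"
    using L2_set_le_sum[of "{..<n}" "\<lambda>i. \<bar>(map_mat real_of_rat f *\<^sub>v v) $ i\<bar>"]
    by (simp add: real_vec_norm_def L2_set_def)
  also have "\<dots> \<le> (\<Sum>i<n. real n * c)" by (intro sum_mono row) auto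
  finally show "real_vec_norm n (map_mat real_of_rat f *\<^sub>v v) \<le> real n * (real n * c)" by simp
qed

lemma abs_le_op_norm_infinite_place:
  assumes f: "f \<in> carrier_mat n n" and ij: "i < n" "j < n"
  shows "ennreal \<bar>real_of_rat (f $$ (i, j))\<bar> \<le> op_norm n Infinite_Place f"
proof -
  have "real_vec_norm n (unit_vec n j) = 1"
  proof -
    have "(\<Sum>i<n. \<bar>unit_vec n j $ i :: real\<bar>\<^sup>2) = (\<Sum>i<n. if i = j then 1 else 0)"
      using ij by (intro sum.cong) auto
    then show ?thesis using ij by (simp add: real_vec_norm_def)
  qed
  then have "ennreal (real_vec_norm n (map_mat real_of_rat f *\<^sub>v unit_vec n j)) \<le> op_norm n Infinite_Place f"
    by (auto intro!: SUP_upper2)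
  moreover have "\<bar>real_of_rat (f $$ (i, j))\<bar> \<le> real_vec_norm n (map_mat real_of_rat f *\<^sub>v unit_vec n j)"
  proof -
    have "sqrt (\<bar>(map_mat real_of_rat f *\<^sub>v unit_vec n j) $ i\<bar>\<^sup>2)
        \<le> real_vec_norm n (map_mat real_of_rat f *\<^sub>v unit_vec n j)"
      unfolding real_vec_norm_def using ij by (intro real_sqrt_le_mono member_le_sum) auto
    then show ?thesis using f ij by simp
  qed
  ultimately show ?thesis by (meson ennreal_leI order.trans)
qed

section \<open>Balls for the word length\<close>

lemma mult_GL [simp]: "A \<otimes>\<^bsub>GL n\<^esub> B = A * B"
  by (simp add: GL_def units_of_def ring_mat_def)

lemma one_GL [simp]: "\<one>\<^bsub>GL n\<^esub> = 1\<^sub>m n"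
  by (simp add: GL_def units_of_def ring_mat_def)

lemma carrier_GL:
  "carrier (GL n) = {A \<in> carrier_mat n n. \<exists>B\<in>carrier_mat n n. B * A = 1\<^sub>m n \<and> A * B = 1\<^sub>m n}"
  by (simp add: GL_def units_of_def ring_mat_def Units_def)

lemma GL_carrier_mat: "A \<in> carrier (GL n) \<Longrightarrow> A \<in> carrier_mat n n"
  by (simp add: carrier_GL)

lemma theta_carrier_mat [simp]: "theta n r s q \<in> carrier_mat n n"
  by (simp add: theta_def)

text \<open>Left multiplication by \<open>theta\<close> is a row operation. The matrix identities
  below are checked entrywise with this formula, which is why \<open>index_mult_mat(1)\<close> is
  removed from the simpset there.\<close>

lemma theta_mult_index:
  assumes "A \<in> carrier_mat n n" "r < n" "s < n" "i < n" "j < n"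
  shows "(theta n r s q * A) $$ (i, j) =
    (if i = r then (if r = s then q * A $$ (r, j) else A $$ (r, j) + q * A $$ (s, j)) else A $$ (i, j))"
proof -
  have "(theta n r s q * A) $$ (i, j) =
      (\<Sum>k<n. (if i = r \<and> k = s then q else if i = k then 1 else 0) * A $$ (k, j))"
    using assms by (auto simp: theta_def scalar_prod_def lessThan_atLeast0 intro!: sum.cong)
  \<comment> \<open>The row is split into its contributions at columns \<open>s\<close> and
    \<open>i\<close>. The second is suppressed for \<open>i = r = s\<close>, where the two positions
    coincide.\<close>
  also have "\<dots> = (\<Sum>k<n. (if k = s then (if i = r then q * A $$ (s, j) else 0) else 0) +
      (if k = i then (if i = r \<and> r = s then 0 else A $$ (i, j)) else 0))"
    by (intro sum.cong) auto
  also have "\<dots> = (if i = r then q * A $$ (s, j) else 0) + (if i = r \<and> r = s then 0 else A $$ (i, j))"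
    using assms by (simp add: sum.distrib)
  finally show ?thesis by auto
qed

lemma theta_index:
  "i < n \<Longrightarrow> j < n \<Longrightarrow> theta n r s q $$ (i, j) = (if i = r \<and> j = s then q else if i = j then 1 else 0)"
  by (simp add: theta_def)

lemma theta_dim [simp]: "dim_row (theta n r s q) = n" "dim_col (theta n r s q) = n"
  by (simp_all add: theta_def)

lemma theta_diag_1 [simp]: "theta n r r 1 = 1\<^sub>m n"
  by (rule eq_matI) (auto simp: theta_index)

lemma theta_0 [simp]: "r \<noteq> s \<Longrightarrow> theta n r s 0 = 1\<^sub>m n"
  by (rule eq_matI) (auto simp: theta_index)

lemma theta_diag_mult: "r < n \<Longrightarrow> theta n r r x * theta n r r y = theta n r r (x * y)"
  by (rule eq_matI) (auto simp: theta_mult_index theta_index simp del: index_mult_mat(1))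

lemma theta_add:
  "r < n \<Longrightarrow> s < n \<Longrightarrow> r \<noteq> s \<Longrightarrow> theta n r s x * theta n r s y = theta n r s (x + y)"
  by (rule eq_matI) (auto simp: theta_mult_index theta_index simp del: index_mult_mat(1))

text \<open>Conjugation by a diagonal matrix rescales an off-diagonal entry. With \<open>m\<close>
  in \<open>P\<close> this is the base-\<open>p\<close> shift in the Horner scheme, and with
  \<open>1 / m\<close> it introduces denominators.\<close>

lemma theta_conj_diag:
  assumes "r < n" "s < n" "r \<noteq> s" "m \<noteq> 0"
  shows "theta n s s (1 / m) * (theta n r s x * theta n s s m) = theta n r s (m * x)"
proof -
  have c: "theta n r s x * theta n s s m \<in> carrier_mat n n" by (meson mult_carrier_mat theta_carrier_mat)
  show ?thesis
    using assms c
    by (intro eq_matI) (auto simp: theta_mult_index theta_index simp del: index_mult_mat(1))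
qed

lemma theta_diag_GL:
  assumes "r < n" "q \<noteq> 0"
  shows "theta n r r q \<in> carrier (GL n)" "inv\<^bsub>GL n\<^esub> (theta n r r q) = theta n r r (1 / q)"
proof -
  interpret group "GL n" by (rule group_GL)
  have *: "theta n r r x \<in> carrier (GL n)" if "x \<noteq> 0" for x
    unfolding carrier_GL using that assms
    by (auto simp: theta_diag_mult intro!: bexI[of _ "theta n r r (1 / x)"])
  show "theta n r r q \<in> carrier (GL n)" using * assms by simp
  show "inv\<^bsub>GL n\<^esub> (theta n r r q) = theta n r r (1 / q)"
    using assms *[of q] *[of "1 / q"] by (intro inv_equality) (auto simp: theta_diag_mult)
qed

lemma theta_GL:
  assumes "r < n" "s < n" "r \<noteq> s"
  shows "theta n r s q \<in> carrier (GL n)" "inv\<^bsub>GL n\<^esub> (theta n r s q) = theta n r s (- q)"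
proof -
  interpret group "GL n" by (rule group_GL)
  have *: "theta n r s x \<in> carrier (GL n)" for x
    unfolding carrier_GL using assms
    by (auto simp: theta_add intro!: bexI[of _ "theta n r s (- x)"])
  show "theta n r s q \<in> carrier (GL n)" using * assms by simp
  show "inv\<^bsub>GL n\<^esub> (theta n r s q) = theta n r s (- q)"
    using assms *[of q] *[of "- q"] by (intro inv_equality) (auto simp: theta_add)
qed

text \<open>Makes the inverses among the generators explicit; \<open>0 \<notin> P\<close> ensures
  that the diagonal matrices are invertible.\<close>

lemma K_gens_alt:
  assumes "0 \<notin> P"
  shows "K_gens n P = {theta n r s e | r s e. r < s \<and> s < n \<and> (e = 1 \<or> e = -1)} \<union>
     {theta n r r q | r q p. r < n \<and> p \<in> P \<and> (q = of_nat p \<or> q = 1 / of_nat p)}"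
proof -
  have p0: "of_nat p \<noteq> (0::rat)" if "p \<in> P" for p using assms that by (metis of_nat_eq_0_iff)
  show ?thesis
    using p0 by (fastforce simp: K_gens_def U_gens_def J_gens_def theta_GL theta_diag_GL)
qed

lemma theta_mem_K_gens:
  assumes "0 \<notin> P" "r < s" "s < n" "e = 1 \<or> e = -1"
  shows "theta n r s e \<in> K_gens n P"
  unfolding K_gens_alt[OF assms(1)] using assms(2-) by blast

lemma theta_diag_mem_K_gens:
  assumes "0 \<notin> P" "r < n" "p \<in> P"
  shows "theta n r r (of_nat p) \<in> K_gens n P" "theta n r r (1 / of_nat p) \<in> K_gens n P"
  unfolding K_gens_alt[OF assms(1)] using assms(2-) by blast+

lemma K_gens_cases:
  assumes "0 \<notin> P" "g \<in> K_gens n P"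
  obtains (offdiag) r s e where "g = theta n r s e" "r < s" "s < n" "e = 1 \<or> e = -1"
    | (diag) r p q where "g = theta n r r q" "r < n" "p \<in> P" "q = of_nat p \<or> q = 1 / of_nat p" "q \<noteq> 0"
proof -
  have "of_nat p \<noteq> (0::rat)" if "p \<in> P" for p using assms(1) that by (metis of_nat_eq_0_iff)
  then have "q \<noteq> 0" if "p \<in> P" "q = of_nat p \<or> q = 1 / of_nat p" for p and q :: rat
    using that by (metis divide_eq_0_iff one_neq_zero)
  moreover have "(\<exists>r s e. g = theta n r s e \<and> r < s \<and> s < n \<and> (e = 1 \<or> e = -1)) \<or>
      (\<exists>r q p. g = theta n r r q \<and> r < n \<and> p \<in> P \<and> (q = of_nat p \<or> q = 1 / of_nat p))"
    using assms(2) unfolding K_gens_alt[OF assms(1)] Un_iff mem_Collect_eq .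
  ultimately show thesis
    using offdiag diag by metis
qed

lemma K_gens_GL:
  assumes "0 \<notin> P"
  shows "K_gens n P \<subseteq> carrier (GL n)"
proof
  fix g assume "g \<in> K_gens n P"
  with assms show "g \<in> carrier (GL n)"
    by (cases rule: K_gens_cases) (simp_all add: theta_GL theta_diag_GL)
qed

lemma K_gens_inv:
  assumes "0 \<notin> P" and "g \<in> K_gens n P"
  shows "inv\<^bsub>GL n\<^esub> g \<in> K_gens n P"
  using assms
proof (cases rule: K_gens_cases)
  case (offdiag r s e)
  then have "inv\<^bsub>GL n\<^esub> g = theta n r s (- e)" by (simp add: theta_GL)
  moreover have "theta n r s (- e) \<in> K_gens n P"
    using assms(1) offdiag by (intro theta_mem_K_gens) auto
  ultimately show ?thesis by simp
next
  case (diag r p q)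
  then have "inv\<^bsub>GL n\<^esub> g = theta n r r (1 / q)" by (simp add: theta_diag_GL)
  then show ?thesis using diag theta_diag_mem_K_gens[OF assms(1), of r n p] by auto
qed

text \<open>The radius is real so that logarithmic bounds can be added and compared without
  rounding.\<close>

definition word_ball :: "nat \<Rightarrow> nat set \<Rightarrow> real \<Rightarrow> rat mat set" where
  "word_ball n P c = {f. \<exists>ws. real (length ws) \<le> c \<and> set ws \<subseteq> K_gens n P \<and>
     foldr (\<otimes>\<^bsub>GL n\<^esub>) ws \<one>\<^bsub>GL n\<^esub> = f}"

lemma word_ball_mono: "f \<in> word_ball n P c \<Longrightarrow> c \<le> d \<Longrightarrow> f \<in> word_ball n P d"
  unfolding word_ball_def by (blast intro: order.trans)

lemma word_length_le:
  assumes "f \<in> word_ball n P c"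
  shows "real (word_length n P f) \<le> c"
proof -
  obtain ws where ws: "real (length ws) \<le> c" "set ws \<subseteq> K_gens n P"
      "foldr (\<otimes>\<^bsub>GL n\<^esub>) ws \<one>\<^bsub>GL n\<^esub> = f"
    using assms by (auto simp: word_ball_def)
  then have "word_length n P f \<le> length ws"
    unfolding word_length_def by (intro Least_le) blast
  then show ?thesis using ws(1) by linarith
qed

section \<open>Products and inverses in word balls\<close>

lemma (in monoid) foldr_mult_closed:
  "set ws \<subseteq> carrier G \<Longrightarrow> foldr (\<otimes>) ws \<one> \<in> carrier G"
  by (induction ws) auto

lemma (in monoid) foldr_mult_append:
  assumes "set vs \<subseteq> carrier G" "set ws \<subseteq> carrier G"
  shows "foldr (\<otimes>) (vs @ ws) \<one> = foldr (\<otimes>) vs \<one> \<otimes> foldr (\<otimes>) ws \<one>"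
  using assms by (induction vs) (auto simp: foldr_mult_closed m_assoc simp del: foldr_append simp flip: foldr_append)

context
  fixes P :: "nat set"
  assumes zero_notin_P: "0 \<notin> P"
begin

lemma word_ball_mult:
  assumes "f \<in> word_ball n P c" "g \<in> word_ball n P d"
  shows "f * g \<in> word_ball n P (c + d)"
proof -
  interpret group "GL n" by (rule group_GL)
  obtain vs where vs: "real (length vs) \<le> c" "set vs \<subseteq> K_gens n P"
      "foldr (\<otimes>\<^bsub>GL n\<^esub>) vs \<one>\<^bsub>GL n\<^esub> = f"
    using assms by (auto simp: word_ball_def)
  obtain ws where ws: "real (length ws) \<le> d" "set ws \<subseteq> K_gens n P"
      "foldr (\<otimes>\<^bsub>GL n\<^esub>) ws \<one>\<^bsub>GL n\<^esub> = g"
    using assms by (auto simp: word_ball_def)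
  have "foldr (\<otimes>\<^bsub>GL n\<^esub>) (vs @ ws) \<one>\<^bsub>GL n\<^esub> = f * g"
    using foldr_mult_append[of vs ws] vs ws K_gens_GL[OF zero_notin_P] by (auto simp del: one_GL foldr_append)
  then show ?thesis
    unfolding word_ball_def using vs ws by (intro CollectI exI[of _ "vs @ ws"]) auto
qed

lemma one_word_ball: "c \<ge> 0 \<Longrightarrow> 1\<^sub>m n \<in> word_ball n P c"
  unfolding word_ball_def by (intro CollectI exI[of _ "[]"]) auto

lemma gen_word_ball: "g \<in> K_gens n P \<Longrightarrow> g \<in> word_ball n P 1"
  unfolding word_ball_def
  using GL_carrier_mat[of g n] K_gens_GL[OF zero_notin_P, of n]
  by (intro CollectI exI[of _ "[g]"]) auto

text \<open>The inverse of a word is the reversed word of inverted letters, and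
  \<open>K_gens\<close> is closed under inversion.\<close>

lemma inv_word_ball:
  assumes "f \<in> word_ball n P c"
  shows "inv\<^bsub>GL n\<^esub> f \<in> word_ball n P c"
proof -
  interpret group "GL n" by (rule group_GL)
  have inv: "inv\<^bsub>GL n\<^esub> (foldr (\<otimes>\<^bsub>GL n\<^esub>) ws \<one>\<^bsub>GL n\<^esub>) \<in> word_ball n P (real (length ws))"
    if "set ws \<subseteq> K_gens n P" for ws
    using that
  proof (induction ws)
    case Nil
    then show ?case using inv_one one_word_ball[of 0] by simp
  next
    case (Cons g ws)
    have g: "g \<in> carrier (GL n)" and ws: "set ws \<subseteq> carrier (GL n)"
      using Cons.prems K_gens_GL[OF zero_notin_P] by auto
    have "inv\<^bsub>GL n\<^esub> (g \<otimes>\<^bsub>GL n\<^esub> foldr (\<otimes>\<^bsub>GL n\<^esub>) ws \<one>\<^bsub>GL n\<^esub>) =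
        inv\<^bsub>GL n\<^esub> (foldr (\<otimes>\<^bsub>GL n\<^esub>) ws \<one>\<^bsub>GL n\<^esub>) * inv\<^bsub>GL n\<^esub> g"
      using inv_mult_group[OF g foldr_mult_closed[OF ws]] by simp
    also have "\<dots> \<in> word_ball n P (real (length ws) + 1)"
      using Cons.prems K_gens_inv[OF zero_notin_P]
      by (intro word_ball_mult Cons.IH gen_word_ball) auto
    finally have "inv\<^bsub>GL n\<^esub> (foldr (\<otimes>\<^bsub>GL n\<^esub>) (g # ws) \<one>\<^bsub>GL n\<^esub>) \<in> word_ball n P (real (length ws) + 1)"
      by (simp only: foldr.simps o_apply)
    then show ?case by (rule word_ball_mono) simp
  qed
  obtain ws where ws: "real (length ws) \<le> c" "set ws \<subseteq> K_gens n P"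
      "foldr (\<otimes>\<^bsub>GL n\<^esub>) ws \<one>\<^bsub>GL n\<^esub> = f"
    using assms by (auto simp: word_ball_def)
  show ?thesis using word_ball_mono[OF inv[OF ws(2)] ws(1)] ws(3) by simp
qed

lemma FG_word_ball:
  assumes "f \<in> FG n P"
  obtains c where "f \<in> word_ball n P c"
proof -
  have "\<exists>c. f \<in> word_ball n P c"
    using assms unfolding FG_def
  proof (induction rule: generate.induct)
    case one
    then show ?case using one_word_ball[of 0] by auto
  next
    case (incl h)
    then show ?case using gen_word_ball[of h n] by auto
  next
    case (inv h)
    then show ?case using gen_word_ball[OF K_gens_inv[OF zero_notin_P inv]] by auto
  next
    case (eng h1 h2)
    then obtain c d where "h1 \<in> word_ball n P c" "h2 \<in> word_ball n P d" by blast
    then show ?case using word_ball_mult[of h1 n c h2 d] by auto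
  qed
  then show ?thesis using that by blast
qed

text \<open>The \<open>LEAST\<close> in \<open>word_length\<close> is attained, because an element
  of the generated group is the value of at least one word.\<close>

lemma FG_word_ball_word_length:
  assumes "f \<in> FG n P"
  shows "f \<in> word_ball n P (real (word_length n P f))"
proof -
  obtain c where "f \<in> word_ball n P c" using FG_word_ball[OF assms] .
  then obtain vs where vs: "set vs \<subseteq> K_gens n P" "foldr (\<otimes>\<^bsub>GL n\<^esub>) vs \<one>\<^bsub>GL n\<^esub> = f"
    unfolding word_ball_def by blast
  let ?Q = "\<lambda>k. \<exists>ws. length ws = k \<and> set ws \<subseteq> K_gens n P \<and> foldr (\<otimes>\<^bsub>GL n\<^esub>) ws \<one>\<^bsub>GL n\<^esub> = f"
  have "?Q (word_length n P f)"
    unfolding word_length_def by (rule LeastI[of ?Q "length vs"]) (use vs in blast)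
  then show ?thesis unfolding word_ball_def by force
qed

end

section \<open>Words for upper triangular matrices\<close>

text \<open>Starting from the identity, \<open>f\<close> is filled in column by column from the left
  and from top to bottom within a column. Each entry on or above the diagonal costs one left
  multiplication by some \<open>theta\<close>.\<close>

lemma upper_triangular_word_ball:
  assumes P: "0 \<notin> P" and f: "f \<in> carrier_mat n n" and c: "c \<ge> 0"
    and upper: "\<And>i j. j < i \<Longrightarrow> i < n \<Longrightarrow> f $$ (i, j) = 0"
    and entries: "\<And>r k. r \<le> k \<Longrightarrow> k < n \<Longrightarrow> theta n r k (f $$ (r, k)) \<in> word_ball n P c"
  shows "f \<in> word_ball n P (real n * real n * c)"
proof -
  \<comment> \<open>\<open>B k r\<close> is the partially filled matrix: it agrees with
    \<open>f\<close> in the columns before \<open>k\<close> and in the first \<open>r\<close>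
    entries of column \<open>k\<close>, and with the identity elsewhere.\<close>
  define B where "B k r = mat n n (\<lambda>(i, j). if j < k \<or> (j = k \<and> i < r) then f $$ (i, j)
    else if i = j then 1 else 0)" for k r
  have B_carrier [simp]: "B k r \<in> carrier_mat n n" for k r by (simp add: B_def)
  have B_index: "B k r $$ (i, j) = (if j < k \<or> (j = k \<and> i < r) then f $$ (i, j)
    else if i = j then 1 else 0)" if "i < n" "j < n" for i j k r
    using that by (simp add: B_def)
  have B_dim [simp]: "dim_row (B k r) = n" "dim_col (B k r) = n" for k r by (simp_all add: B_def)
  \<comment> \<open>Row \<open>k\<close> of \<open>B k r\<close> is still the \<open>k\<close>-th
    unit row, since \<open>f\<close> vanishes to the left of the diagonal. Adding a multiple of it
    to row \<open>r\<close> changes only the entry in column \<open>k\<close>.\<close>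
  have step: "theta n r k (f $$ (r, k)) * B k r = B k (Suc r)" if "r < k" "k < n" for r k
    using that upper by (intro eq_matI)
      (auto simp: theta_mult_index B_index less_Suc_eq simp del: index_mult_mat(1))
  \<comment> \<open>Scaling the unit row \<open>k\<close> sets the diagonal entry; the entries of
    \<open>f\<close> below it are 0, so column \<open>k\<close> is then complete.\<close>
  have step_diag: "theta n k k (f $$ (k, k)) * B k k = B (Suc k) 0" if "k < n" for k
    using that upper by (intro eq_matI)
      (auto simp: theta_mult_index B_index less_Suc_eq not_less simp del: index_mult_mat(1))
  have col: "B k r \<in> word_ball n P (d + real r * c)"
    if "B k 0 \<in> word_ball n P d" "r \<le> k" "k < n" for k r d
    using \<open>r \<le> k\<close>
  proof (induction r)
    case 0
    then show ?case using that by simp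
  next
    case (Suc r)
    have "theta n r k (f $$ (r, k)) * B k r \<in> word_ball n P (c + (d + real r * c))"
      using Suc that by (intro word_ball_mult P entries) auto
    then show ?case using Suc that by (simp add: step algebra_simps)
  qed
  have "B k 0 \<in> word_ball n P (real k * (real n * c))" if "k \<le> n" for k
    using that
  proof (induction k)
    case 0
    have "B 0 0 = 1\<^sub>m n" by (intro eq_matI) (auto simp: B_index)
    then show ?case using one_word_ball[OF P, of 0] by simp
  next
    case (Suc k)
    have "theta n k k (f $$ (k, k)) * B k k \<in> word_ball n P (c + (real k * (real n * c) + real k * c))"
      using Suc by (intro word_ball_mult P entries col) auto
    \<comment> \<open>Column \<open>k\<close> takes \<open>k + 1\<close> factors, which is at most
      \<open>n\<close>.\<close>
    moreover have "c + real k * c \<le> real n * c"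
      using Suc.prems mult_right_mono[OF _ c, of "1 + real k" "real n"] by (simp add: algebra_simps)
    ultimately show ?case
      using Suc.prems by (auto simp: step_diag algebra_simps elim!: word_ball_mono)
  qed
  moreover have "B n 0 = f"
    using f by (intro eq_matI) (auto simp: B_index)
  ultimately show ?thesis by (metis mult.assoc order.refl)
qed

text \<open>Splitting off a prime factor of \<open>a\<close> costs one generator and lowers
  \<open>ln (real a)\<close> by at least \<open>ln 2\<close>.\<close>

lemma word_ball_theta_diag:
  assumes P: "0 \<notin> P" and r: "r < n" and a: "a > 0" "prime_factors a \<subseteq> P"
  shows "theta n r r (of_nat a) \<in> word_ball n P (ln (real a) / ln 2) \<and>
    theta n r r (1 / of_nat a) \<in> word_ball n P (ln (real a) / ln 2)"
  using a
proof (induction a rule: less_induct)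
  case (less a)
  show ?case
  proof (cases "a = 1")
    case True
    then show ?thesis using one_word_ball[OF P] by simp
  next
    case False
    then obtain q where q: "prime q" "q dvd a" using prime_factor_nat by blast
    then obtain b where b: "a = q * b" by auto
    have q2: "q \<ge> 2" using q prime_ge_2_nat by blast
    have b0: "b > 0" "b < a" using less.prems b q2 by auto
    have qP: "q \<in> P" using less.prems q by (auto simp: prime_factors_dvd)
    have "prime_factors b \<subseteq> P" using less.prems b by (auto simp: prime_factors_dvd)
    from less.IH[OF b0(2,1) this]
    have IH: "theta n r r (of_nat b) \<in> word_ball n P (ln (real b) / ln 2)"
      "theta n r r (1 / of_nat b) \<in> word_ball n P (ln (real b) / ln 2)" by auto
    have "ln (real a) = ln (real q) + ln (real b)"
      using b b0 q2 by (simp add: ln_mult)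
    moreover have "ln 2 \<le> ln (real q)" using q2 by simp
    ultimately have le: "1 + ln (real b) / ln 2 \<le> ln (real a) / ln 2"
      by (simp add: field_simps)
    have "theta n r r (of_nat q) * theta n r r (of_nat b) \<in> word_ball n P (1 + ln (real b) / ln 2)"
      "theta n r r (1 / of_nat q) * theta n r r (1 / of_nat b) \<in> word_ball n P (1 + ln (real b) / ln 2)"
      using IH qP r by (auto intro!: word_ball_mult P gen_word_ball theta_diag_mem_K_gens)
    then show ?thesis
      using le r by (auto simp: theta_diag_mult b elim!: word_ball_mono)
  qed
qed

lemma word_ball_theta_small:
  assumes P: "0 \<notin> P" and rs: "r < s" "s < n" and e: "e = 1 \<or> e = -1"
  shows "theta n r s (e * of_nat a) \<in> word_ball n P (real a)"
proof (induction a)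
  case 0
  then show ?case using one_word_ball[OF P, of 0] rs by simp
next
  case (Suc a)
  have "theta n r s e * theta n r s (e * of_nat a) \<in> word_ball n P (1 + real a)"
    using assms Suc by (intro word_ball_mult P gen_word_ball theta_mem_K_gens) auto
  then show ?case using rs by (simp add: theta_add algebra_simps)
qed

text \<open>Horner's scheme in base \<open>p\<close>, where multiplication by \<open>p\<close> is conjugation by a diagonal
  generator, makes the word length logarithmic in the entry.\<close>

lemma word_ball_theta_nat:
  assumes P: "0 \<notin> P" and p: "p \<in> P" "p \<ge> 2" and rs: "r < s" "s < n" and e: "e = 1 \<or> e = -1"
  shows "theta n r s (e * of_nat a) \<in> word_ball n P ((real p + 2) * (1 + ln (real a) / ln 2))"
proof (induction a rule: less_induct)
  case (less a)
  show ?case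
  proof (cases "a < p")
    case True
    \<comment> \<open>This includes \<open>a = 0\<close>, where \<open>ln 0 = 0\<close> by
      convention.\<close>
    have "ln (real a) \<ge> 0" by (cases "a = 0") auto
    then have "real a * 1 \<le> (real p + 2) * (1 + ln (real a) / ln 2)"
      using True by (intro mult_mono) auto
    then show ?thesis
      using word_ball_theta_small[OF P rs e, of a] by (auto elim: word_ball_mono)
  next
    case False
    define b where "b = a div p"
    have b: "b > 0" "b < a" using False p by (auto simp: b_def div_greater_zero_iff)
    have a: "a = p * b + a mod p" by (simp add: b_def)
    have "theta n s s (1 / of_nat p) * (theta n r s (e * of_nat b) * theta n s s (of_nat p)) \<in>
        word_ball n P (1 + ((real p + 2) * (1 + ln (real b) / ln 2) + 1))"
      using less.IH[OF b(2)] rs p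
      by (intro word_ball_mult P gen_word_ball theta_diag_mem_K_gens) auto
    then have "theta n r s (of_nat p * (e * of_nat b)) \<in>
        word_ball n P (1 + ((real p + 2) * (1 + ln (real b) / ln 2) + 1))"
      using rs p by (simp add: theta_conj_diag)
    from word_ball_mult[OF P this word_ball_theta_small[OF P rs e, of "a mod p"]]
    have "theta n r s (of_nat p * (e * of_nat b) + e * of_nat (a mod p)) \<in>
        word_ball n P (1 + ((real p + 2) * (1 + ln (real b) / ln 2) + 1) + real (a mod p))"
      using rs by (simp add: theta_add)
    moreover have "of_nat p * (e * of_nat b) + e * of_nat (a mod p) = e * (of_nat a :: rat)"
      by (subst (2) a) (simp add: algebra_simps)
    \<comment> \<open>One digit costs two conjugating generators and fewer than \<open>p\<close>
      unit steps, at most \<open>p + 2\<close> in all. Passing from \<open>a\<close> to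
      \<open>b\<close> at least halves the number, so the logarithm to base 2 drops by at least 1
      and pays for this.\<close>
    moreover have "1 + ((real p + 2) * (1 + ln (real b) / ln 2) + 1) + real (a mod p) \<le>
        (real p + 2) * (1 + ln (real a) / ln 2)"
    proof -
      have "2 * b \<le> p * b" using p by simp
      then have "2 * b \<le> a" using a by linarith
      then have "ln (2 * real b) \<le> ln (real a)" using b by (subst ln_le_cancel_iff) (auto simp flip: of_nat_mult)
      then have "1 + ln (real b) / ln 2 \<le> ln (real a) / ln 2"
        using b divide_right_mono[of "ln (2 * real b)" "ln (real a)" "ln 2"]
        by (simp add: ln_mult add_divide_distrib)
      then have "(real p + 2) * (1 + ln (real b) / ln 2) \<le> (real p + 2) * (ln (real a) / ln 2)"
        by (intro mult_left_mono) auto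
      moreover have "a mod p < p" using p by simp
      ultimately show ?thesis by (simp add: algebra_simps)
    qed
    ultimately show ?thesis by (simp add: word_ball_mono)
  qed
qed

text \<open>The denominator is produced by conjugating the matrix of the numerator with
  \<open>theta n s s (of_nat b)\<close>; each of the two conjugating factors accounts for one
  \<open>ln (real b) / ln 2\<close>.\<close>

lemma word_ball_theta_fract:
  assumes P: "0 \<notin> P" and p: "p \<in> P" "p \<ge> 2" and rs: "r < s" "s < n" and e: "e = 1 \<or> e = -1"
    and b: "b > 0" "prime_factors b \<subseteq> P"
  shows "theta n r s (e * of_nat a / of_nat b) \<in>
    word_ball n P ((real p + 2) * (1 + ln (real a) / ln 2) + 2 * (ln (real b) / ln 2))"
proof -
  note [simp] = word_ball_theta_diag[OF P rs(2) b]
  have "theta n s s (of_nat b) * (theta n r s (e * of_nat a) * theta n s s (1 / of_nat b)) \<in>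
      word_ball n P (ln (real b) / ln 2 + ((real p + 2) * (1 + ln (real a) / ln 2) + ln (real b) / ln 2))"
    by (intro word_ball_mult P word_ball_theta_nat[OF assms(1-6)]) auto
  moreover have "theta n s s (of_nat b) * (theta n r s (e * of_nat a) * theta n s s (1 / of_nat b)) =
      theta n r s (e * of_nat a / of_nat b)"
    using theta_conj_diag[of r n s "1 / of_nat b" "e * of_nat a"] rs b by simp
  ultimately show ?thesis by (auto elim: word_ball_mono)
qed

lemma word_ball_theta_diag_fract:
  assumes P: "0 \<notin> P" and r: "r < n" and a: "a > 0" "prime_factors a \<subseteq> P"
    and b: "b > 0" "prime_factors b \<subseteq> P"
  shows "theta n r r (of_nat a / of_nat b) \<in> word_ball n P (ln (real a) / ln 2 + ln (real b) / ln 2)"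
proof -
  have "theta n r r (of_nat a) * theta n r r (1 / of_nat b) \<in>
      word_ball n P (ln (real a) / ln 2 + ln (real b) / ln 2)"
    using word_ball_theta_diag[OF P r a] word_ball_theta_diag[OF P r b]
    by (intro word_ball_mult P) auto
  then show ?thesis using r by (simp add: theta_diag_mult)
qed

section \<open>Entries of products of generators\<close>

lemma multiplicity_int: "multiplicity (int q) (int a) = multiplicity q a"
  by (simp add: multiplicity_def flip: of_nat_power)

lemma padic_abs_of_nat:
  assumes "prime q" "a > 0"
  shows "padic_abs q (of_nat a) = 1 / real q ^ multiplicity q a"
  using padic_abs_fract[OF assms(1), of "int a" 1] assms(2)
  by (simp add: power_int_minus divide_inverse multiplicity_int)

lemma padic_abs_inverse:
  assumes "prime q"
  shows "padic_abs q (1 / x) = 1 / padic_abs q x"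
proof (cases "x = 0")
  case False
  have "padic_abs q (1 / x) * padic_abs q x = 1"
    using False assms by (simp flip: padic_abs_mult[OF assms])
  then show ?thesis by (metis False assms less_irrefl nonzero_eq_divide_eq padic_abs_pos)
qed simp

lemma padic_abs_of_prime:
  assumes "prime q" "prime p"
  shows "padic_abs q (of_nat p) = (if p = q then 1 / real q else 1)"
  using assms prime_gt_0_nat[OF assms(2)]
  by (simp add: padic_abs_of_nat prime_multiplicity_other multiplicity_self)

text \<open>The factor by which one generator can enlarge the entries at a place. At a prime
  \<open>q\<close> of \<open>P\<close> it comes from scaling by \<open>1 / q\<close>; elsewhere
  generators are integral. At infinity it covers both doubling by a row addition and scaling by any
  prime of \<open>P\<close>.\<close>

definition word_bound :: "nat set \<Rightarrow> place \<Rightarrow> real" where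
  "word_bound P v = (case v of Finite_Place q \<Rightarrow> if q \<in> P then real q else 1
     | Infinite_Place \<Rightarrow> 2 + real (\<Sum>P))"

lemma word_bound_ge_1:
  assumes "0 \<notin> P"
  shows "word_bound P v \<ge> 1"
proof -
  have "1 \<le> real q" if "q \<in> P" for q using assms that by (cases q) auto
  then show ?thesis by (simp add: word_bound_def sum_nonneg add_increasing2 split: place.split)
qed

text \<open>The invariant of an induction over words of length \<open>k\<close>. The diagonal clause
  forces diagonal entries to be positive fractions with only primes of \<open>P\<close> above and
  below, so that they are products of diagonal generators.\<close>

definition word_controlled :: "nat \<Rightarrow> nat set \<Rightarrow> nat \<Rightarrow> rat mat \<Rightarrow> bool" where
  "word_controlled n P k f \<longleftrightarrow> f \<in> carrier_mat n n \<and> (\<forall>i<n. \<forall>j<n.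
     (j < i \<longrightarrow> f $$ (i, j) = 0) \<and>
     (j = i \<longrightarrow> f $$ (i, j) > 0 \<and> (\<forall>q. prime q \<longrightarrow> q \<notin> P \<longrightarrow> padic_abs q (f $$ (i, j)) = 1)) \<and>
     (\<forall>q. prime q \<longrightarrow> padic_abs q (f $$ (i, j)) \<le> word_bound P (Finite_Place q) ^ k) \<and>
     \<bar>real_of_rat (f $$ (i, j))\<bar> \<le> word_bound P Infinite_Place ^ k)"

text \<open>Prepending a generator performs one row operation, which preserves triangularity and
  enlarges entries at a place by at most the factor \<open>word_bound\<close>.\<close>

lemma word_controlled_word:
  assumes P: "finite P" "\<And>p. p \<in> P \<Longrightarrow> prime p" and ws: "set ws \<subseteq> K_gens n P"
  shows "word_controlled n P (length ws) (foldr (\<otimes>\<^bsub>GL n\<^esub>) ws \<one>\<^bsub>GL n\<^esub>)"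
  using ws
proof (induction ws)
  case Nil
  show ?case by (auto simp: word_controlled_def)
next
  case (Cons g ws)
  have P0: "0 \<notin> P" using P(2) by fastforce
  define f where "f = foldr (\<otimes>\<^bsub>GL n\<^esub>) ws \<one>\<^bsub>GL n\<^esub>"
  define b where "b = word_bound P"
  define k where "k = length ws"
  have "word_controlled n P k f" using Cons by (simp add: f_def k_def del: mult_GL one_GL)
  then have f: "f \<in> carrier_mat n n" "\<And>i j. i < n \<Longrightarrow> j < i \<Longrightarrow> f $$ (i, j) = 0"
    "\<And>i. i < n \<Longrightarrow> f $$ (i, i) > 0"
    "\<And>i q. i < n \<Longrightarrow> prime q \<Longrightarrow> q \<notin> P \<Longrightarrow> padic_abs q (f $$ (i, i)) = 1"
    and fb: "\<And>i j q. i < n \<Longrightarrow> j < n \<Longrightarrow> prime q \<Longrightarrow> padic_abs q (f $$ (i, j)) \<le> b (Finite_Place q) ^ k"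
      "\<And>i j. i < n \<Longrightarrow> j < n \<Longrightarrow> \<bar>real_of_rat (f $$ (i, j))\<bar> \<le> b Infinite_Place ^ k"
    unfolding word_controlled_def b_def by auto
  have b1: "b v \<ge> 1" for v using word_bound_ge_1[OF P0] by (simp add: b_def)
  have bS: "b v ^ k \<le> b v ^ Suc k" for v using b1[of v] by (intro power_increasing) auto
  have b2: "2 \<le> b Infinite_Place" by (simp add: b_def word_bound_def sum_nonneg)
  have "g \<in> K_gens n P" using Cons.prems by simp
  from P0 this have "word_controlled n P (Suc k) (g * f)"
  proof (cases rule: K_gens_cases)
    case (offdiag r s e)
    have s: "r < n" "r \<noteq> s" using offdiag by auto
    have ix: "(g * f) $$ (i, j) = (if i = r then f $$ (r, j) + e * f $$ (s, j) else f $$ (i, j))"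
      if "i < n" "j < n" for i j
      using that s offdiag f(1) by (simp add: theta_mult_index del: index_mult_mat(1))
    have e: "padic_abs q (e * x) = padic_abs q x" "\<bar>real_of_rat (e * x)\<bar> = \<bar>real_of_rat x\<bar>"
      if "prime q" for q x
      using offdiag(4) padic_abs_minus[OF that] by (auto simp: of_rat_minus)
    have pb: "padic_abs q ((g * f) $$ (i, j)) \<le> b (Finite_Place q) ^ Suc k"
      if "i < n" "j < n" "prime q" for i j q
    proof -
      \<comment> \<open>Adding rows causes no growth at a finite place, by the ultrametric
        inequality.\<close>
      have "padic_abs q (f $$ (r, j) + e * f $$ (s, j)) \<le> b (Finite_Place q) ^ k"
        using padic_abs_add[OF that(3), of "f $$ (r, j)" "e * f $$ (s, j)"] that s offdiag(3)
          fb(1)[of r j q] fb(1)[of s j q] by (simp add: e(1))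
      then have "padic_abs q ((g * f) $$ (i, j)) \<le> b (Finite_Place q) ^ k"
        using fb(1)[OF that] by (simp only: ix[OF that(1,2)] split: if_splits) simp
      then show ?thesis using bS order.trans by blast
    qed
    have rb: "\<bar>real_of_rat ((g * f) $$ (i, j))\<bar> \<le> b Infinite_Place ^ Suc k"
      if "i < n" "j < n" for i j
    proof (cases "i = r")
      case True
      have "\<bar>real_of_rat (f $$ (r, j) + e * f $$ (s, j))\<bar>
          \<le> \<bar>real_of_rat (f $$ (r, j))\<bar> + \<bar>real_of_rat (e * f $$ (s, j))\<bar>"
        unfolding of_rat_add by (rule abs_triangle_ineq)
      \<comment> \<open>The facts \<open>e\<close> share the premise that \<open>q\<close> is prime;
        for the real absolute value the prime 2 discharges it.\<close>
      also have "\<dots> \<le> 2 * b Infinite_Place ^ k"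
        using fb(2)[of r j] fb(2)[of s j] s offdiag that e(2)[OF two_is_prime_nat] by simp
      also have "\<dots> \<le> b Infinite_Place ^ Suc k"
        using b2 by (simp add: mult_right_mono)
      finally show ?thesis using True that by (simp add: ix)
    next
      case False
      then show ?thesis using fb(2)[OF that] bS[of Infinite_Place] by (simp add: ix that)
    qed
    \<comment> \<open>Row \<open>s\<close> lies below row \<open>r\<close>, so its entries in
      columns up to \<open>r\<close> are 0: neither the zeros below the diagonal nor the diagonal
      change.\<close>
    have low: "(g * f) $$ (i, j) = 0" if "i < n" "j < i" for i j
      using that offdiag(2,3) f(2) by (simp add: ix del: index_mult_mat(1))
    have dg: "(g * f) $$ (i, i) = f $$ (i, i)" if "i < n" for i
      using that offdiag(2,3) f(2) by (simp add: ix del: index_mult_mat(1))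
    have "g * f \<in> carrier_mat n n" using f offdiag by (auto intro: mult_carrier_mat)
    then show ?thesis
      unfolding word_controlled_def b_def[symmetric]
      using f(3,4) low dg pb rb by (auto simp del: index_mult_mat(1))
  next
    case (diag r p q)
    have p: "prime p" using diag P by auto
    have q0: "q > 0" using diag p prime_gt_0_nat by auto
    have ix: "(g * f) $$ (i, j) = (if i = r then q * f $$ (r, j) else f $$ (i, j))"
      if "i < n" "j < n" for i j
      using that diag f(1) by (simp add: theta_mult_index del: index_mult_mat(1))
    have q1: "padic_abs l q = 1" if "prime l" "l \<notin> P" for l
      using diag that p by (auto simp: padic_abs_of_prime padic_abs_inverse)
    have qb: "padic_abs l q \<le> b (Finite_Place l)" if "prime l" for l
    proof -
      have l1: "1 \<le> real l" using prime_ge_1_nat[OF that] by simp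
      then have "1 / real l \<le> real l" by (simp add: field_simps mult_ge1_I)
      then have "padic_abs l q \<le> (if l \<in> P then real l else 1)"
        using diag(3,4) l1 that p by (auto simp: padic_abs_of_prime padic_abs_inverse)
      then show ?thesis by (simp add: b_def word_bound_def)
    qed
    have qr: "\<bar>real_of_rat q\<bar> \<le> b Infinite_Place"
    proof -
      have "p \<le> \<Sum>P" using P diag by (intro member_le_sum) auto
      then have "real p \<le> 2 + real (\<Sum>P)" by linarith
      moreover have "1 / real p \<le> 1" using prime_ge_1_nat[OF p] by (simp add: field_simps)
      then have "1 / real p \<le> 2 + real (\<Sum>P)" by linarith
      moreover have "\<bar>real_of_rat q\<bar> = real p \<or> \<bar>real_of_rat q\<bar> = 1 / real p"
        using diag(4) by (auto simp: of_rat_divide)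
      ultimately show ?thesis unfolding b_def word_bound_def place.case by metis
    qed
    have pb: "padic_abs l ((g * f) $$ (i, j)) \<le> b (Finite_Place l) ^ Suc k"
      if "i < n" "j < n" "prime l" for i j l
    proof (cases "i = r")
      case True
      have "padic_abs l (q * f $$ (r, j)) \<le> b (Finite_Place l) * b (Finite_Place l) ^ k"
        unfolding padic_abs_mult[OF that(3)]
        using b1[of "Finite_Place l"] True that by (intro mult_mono qb fb) auto
      then show ?thesis using True that by (simp add: ix)
    next
      case False
      then show ?thesis using fb(1)[OF that] bS[of "Finite_Place l"] by (simp add: ix that)
    qed
    have rb: "\<bar>real_of_rat ((g * f) $$ (i, j))\<bar> \<le> b Infinite_Place ^ Suc k"
      if "i < n" "j < n" for i j
    proof (cases "i = r")
      case True
      have "\<bar>real_of_rat q\<bar> * \<bar>real_of_rat (f $$ (r, j))\<bar> \<le> b Infinite_Place * b Infinite_Place ^ k"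
        using b2 True that by (intro mult_mono qr fb) auto
      then show ?thesis using True that by (simp add: ix of_rat_mult abs_mult)
    next
      case False
      then show ?thesis using fb(2)[OF that] bS[of Infinite_Place] by (simp add: ix that)
    qed
    have low: "(g * f) $$ (i, j) = 0" if "i < n" "j < i" for i j
      using that diag(2) f(2) by (simp add: ix del: index_mult_mat(1))
    have dg: "(g * f) $$ (i, i) > 0 \<and> (\<forall>l. prime l \<longrightarrow> l \<notin> P \<longrightarrow> padic_abs l ((g * f) $$ (i, i)) = 1)"
      if "i < n" for i
      using that f(3,4) q0 q1 by (simp add: ix padic_abs_mult del: index_mult_mat(1))
    have "g * f \<in> carrier_mat n n" using f diag by (auto intro: mult_carrier_mat)
    then show ?thesis
      unfolding word_controlled_def b_def[symmetric]
      using low dg pb rb by (auto simp del: index_mult_mat(1))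
  qed
  then have "word_controlled n P (Suc k) (g \<otimes>\<^bsub>GL n\<^esub> f)" by (simp only: mult_GL)
  then show ?case by (simp only: foldr.simps o_apply f_def k_def list.size add_Suc_right add_0_right)
qed

section \<open>Comparison of the two lengths\<close>

lemma ln_plus_mono: "x \<le> y \<Longrightarrow> ln_plus x \<le> ln_plus y"
proof (cases "y = \<top>")
  case False
  assume xy: "x \<le> y"
  have fin: "x \<noteq> \<top>" using xy False by (auto simp: top_unique)
  have "enn2real x \<le> enn2real y" using xy False by (intro enn2real_mono) (auto simp: top.not_eq_extremum)
  then have "max (ln (enn2real x)) 0 \<le> max (ln (enn2real y)) 0"
    using enn2real_nonneg[of x] ln_mono[of "enn2real x" "enn2real y"]
    by (cases "enn2real x = 0") (auto intro!: max.mono simp: less_le)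
  then show ?thesis
    unfolding ln_plus_def using fin False by (simp only: if_False) (rule ennreal_leI)
qed (simp add: ln_plus_def)

lemma ln_plus_ennreal: "r \<ge> 0 \<Longrightarrow> ln_plus (ennreal r) = ennreal (max (ln r) 0)"
  by (simp add: ln_plus_def)

definition place_abs :: "place \<Rightarrow> rat \<Rightarrow> real" where
  "place_abs v x = (case v of Finite_Place p \<Rightarrow> padic_abs p x | Infinite_Place \<Rightarrow> \<bar>real_of_rat x\<bar>)"

lemma place_abs_nonneg: "place_abs v x \<ge> 0"
  by (simp add: place_abs_def split: place.split)

lemma place_abs_le_op_norm:
  assumes "v \<in> places" "f \<in> carrier_mat n n" "i < n" "j < n"
  shows "ennreal (place_abs v (f $$ (i, j))) \<le> op_norm n v f"
  using assms padic_abs_le_op_norm abs_le_op_norm_infinite_place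
  by (auto simp: places_def place_abs_def)

definition places_over :: "nat set \<Rightarrow> place set" where
  "places_over P = insert Infinite_Place (Finite_Place ` P)"

lemma finite_places_over: "finite P \<Longrightarrow> finite (places_over P)"
  by (simp add: places_over_def)

lemma sum_places_over:
  "finite P \<Longrightarrow> (\<Sum>v\<in>places_over P. g v) = (g Infinite_Place :: 'a :: comm_monoid_add) + (\<Sum>p\<in>P. g (Finite_Place p))"
  unfolding places_over_def by (subst sum.insert) (auto simp: sum.reindex inj_on_def)

lemma ln_plus_op_norm_le:
  assumes P: "0 \<notin> P" and f: "word_controlled n P k f" and v: "v \<in> places"
  shows "ln_plus (op_norm n v f) \<le>
    ennreal (real k * ln (word_bound P v) + (if v = Infinite_Place then ln (1 + real n * real n) else 0))"
proof -
  define b where "b = word_bound P v"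
  \<comment> \<open>The dimension factor occurs only at infinity. It is \<open>1 + n * n\<close>
    rather than \<open>n * n\<close> so that its logarithm is nonnegative for \<open>n = 0\<close>
    too.\<close>
  define N where "N = (if v = Infinite_Place then 1 + real n * real n else 1)"
  have b: "b \<ge> 1" using word_bound_ge_1[OF P] by (simp add: b_def)
  have bk: "b ^ k \<ge> 1" using b by simp
  have N: "N \<ge> 1" by (simp add: N_def)
  have "op_norm n v f \<le> ennreal (N * b ^ k)"
  proof (cases v)
    case (Finite_Place p)
    then have "prime p" using v by (auto simp: places_def)
    then have "op_norm n (Finite_Place p) f \<le> ennreal (b ^ k)"
      using bk f Finite_Place
      by (intro op_norm_finite_place_le) (auto simp: word_controlled_def b_def)
    then show ?thesis by (simp add: Finite_Place N_def)
  next
    case Infinite_Place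
    have "op_norm n Infinite_Place f \<le> ennreal (real n * (real n * b ^ k))"
      using bk f Infinite_Place
      by (intro op_norm_infinite_place_le) (auto simp: word_controlled_def b_def)
    also have "\<dots> \<le> ennreal (N * b ^ k)"
      using bk by (intro ennreal_leI) (simp add: N_def Infinite_Place algebra_simps)
    finally show ?thesis by (simp add: Infinite_Place)
  qed
  then have "ln_plus (op_norm n v f) \<le> ln_plus (ennreal (N * b ^ k))" by (rule ln_plus_mono)
  also have "\<dots> = ennreal (max (ln (N * b ^ k)) 0)"
    using N bk by (intro ln_plus_ennreal) auto
  also have "max (ln (N * b ^ k)) 0 = ln (N * b ^ k)"
    using N bk mult_mono[of 1 N 1 "b ^ k"] by (intro max_absorb1) simp
  also have "\<dots> = ln N + real k * ln b"
    using N b by (simp add: ln_mult ln_realpow)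
  finally show ?thesis
    by (cases "v = Infinite_Place") (simp_all add: N_def b_def add.commute del: op_norm.simps)
qed

context
  fixes n :: nat and P :: "nat set"
  assumes finite_P: "finite P" and prime_P: "\<And>p. p \<in> P \<Longrightarrow> prime p"
begin

lemma zero_notin_P: "0 \<notin> P"
  using prime_P by fastforce

text \<open>An element and its inverse lie in the same word ball, so the same bounds hold for both.
  A shorter word also satisfies them, since \<open>word_bound\<close> is at least 1.\<close>

lemma word_controlled_FG:
  assumes "f \<in> FG n P"
  shows "word_controlled n P (word_length n P f) f"
    and "word_controlled n P (word_length n P f) (inv\<^bsub>GL n\<^esub> f)"
proof -
  have bound: "word_controlled n P (word_length n P f) g"
    if g: "g \<in> word_ball n P (real (word_length n P f))" for g
  proof -
    obtain ws where ws: "length ws \<le> word_length n P f" "set ws \<subseteq> K_gens n P"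
        "foldr (\<otimes>\<^bsub>GL n\<^esub>) ws \<one>\<^bsub>GL n\<^esub> = g"
      using g unfolding word_ball_def of_nat_le_iff by blast
    have "word_controlled n P (length ws) g"
      using word_controlled_word[OF finite_P prime_P ws(2)] ws(3) by simp
    moreover have "word_bound P v ^ length ws \<le> word_bound P v ^ word_length n P f" for v
      by (intro power_increasing ws(1) word_bound_ge_1[OF zero_notin_P])
    ultimately show ?thesis
      unfolding word_controlled_def
      by (elim conjE, intro conjI allI impI) (blast intro: order.trans)+
  qed
  have "f \<in> word_ball n P (real (word_length n P f))"
    by (rule FG_word_ball_word_length[OF zero_notin_P assms])
  then show "word_controlled n P (word_length n P f) f"
    and "word_controlled n P (word_length n P f) (inv\<^bsub>GL n\<^esub> f)"
    using bound inv_word_ball[OF zero_notin_P] by auto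
qed

text \<open>At a prime outside \<open>P\<close> the factor \<open>word_bound\<close> is 1, so the
  operator norms of \<open>f\<close> and its inverse are at most 1 and the place contributes
  0.\<close>

lemma adelic_length_FG:
  assumes "f \<in> FG n P"
  shows "adelic_length n f =
    (\<Sum>v\<in>places_over P. ln_plus (op_norm n v f) + ln_plus (op_norm n v (inv\<^bsub>GL n\<^esub> f)))"
proof -
  have "ln_plus (op_norm n v g) = 0"
    if "v \<in> places - places_over P" "word_controlled n P k g" for v g k
    using ln_plus_op_norm_le[OF zero_notin_P that(2), of v] that(1)
    by (auto simp: places_def places_over_def word_bound_def image_iff simp del: op_norm.simps)
  then have "adelic_length n f =
      (\<Sum>\<^sub>\<infinity>v\<in>places_over P. ln_plus (op_norm n v f) + ln_plus (op_norm n v (inv\<^bsub>GL n\<^esub> f)))"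
    unfolding adelic_length_def using word_controlled_FG[OF assms] prime_P
    by (intro infsum_cong_neutral) (auto simp: places_def places_over_def)
  then show ?thesis by (simp add: finite_places_over finite_P)
qed

lemma adelic_length_le_word_length:
  "\<exists>C\<ge>0. \<forall>f\<in>FG n P. adelic_length n f \<le> ennreal C * (1 + of_nat (word_length n P f))"
proof -
  define D where "D = ln (1 + real n * real n)"
  \<comment> \<open>The factor 2 accounts for \<open>f\<close> and its inverse; \<open>D\<close>
    absorbs the dimension factor, which gives the additive constant in the bound.\<close>
  define C where "C = (\<Sum>v\<in>places_over P. 2 * (ln (word_bound P v) + D))"
  have D: "D \<ge> 0" by (simp add: D_def)
  have lb: "ln (word_bound P v) \<ge> 0" for v using word_bound_ge_1[OF zero_notin_P, of v] by simp
  have C: "C \<ge> 0" unfolding C_def using lb D by (intro sum_nonneg) auto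
  have "adelic_length n f \<le> ennreal C * (1 + of_nat (word_length n P f))" if "f \<in> FG n P" for f
  proof -
    define k where "k = word_length n P f"
    have le: "ln_plus (op_norm n v g) \<le> ennreal ((ln (word_bound P v) + D) * (1 + real k))"
      if "v \<in> places_over P" "word_controlled n P k g" for v g
    proof -
      have "v \<in> places" using that(1) prime_P by (auto simp: places_over_def places_def)
      from ln_plus_op_norm_le[OF zero_notin_P that(2) this] show ?thesis
      proof (rule order.trans, intro ennreal_leI)
        have "D \<le> D * (1 + real k)" using D by (simp add: algebra_simps)
        moreover have "ln (1 + real n * real n) = D" by (simp add: D_def)
        ultimately show "real k * ln (word_bound P v) +
            (if v = Infinite_Place then ln (1 + real n * real n) else 0) \<le>
            (ln (word_bound P v) + D) * (1 + real k)"
          using lb[of v] lb[of Infinite_Place] D by (simp add: algebra_simps)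
      qed
    qed
    define t where "t v = (ln (word_bound P v) + D) * (1 + real k)" for v
    have t: "t v \<ge> 0" for v using lb D by (simp add: t_def)
    have "adelic_length n f \<le> (\<Sum>v\<in>places_over P. ennreal (t v) + ennreal (t v))"
      unfolding adelic_length_FG[OF that] t_def using word_controlled_FG[OF that]
      by (intro sum_mono add_mono le) (auto simp: k_def)
    also have "\<dots> = (\<Sum>v\<in>places_over P. ennreal (2 * t v))"
      using t by (simp flip: ennreal_plus)
    also have "\<dots> = ennreal (\<Sum>v\<in>places_over P. 2 * t v)"
      using t by (intro sum_ennreal) simp
    also have "\<dots> = ennreal (C * (1 + real k))"
      unfolding C_def t_def sum_distrib_right by (simp only: mult.assoc)
    also have "\<dots> = ennreal C * (1 + of_nat k)"
      using C by (simp add: ennreal_mult ennreal_plus ennreal_of_nat_eq_real_of_nat)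
    finally show ?thesis by (simp add: k_def)
  qed
  with C show ?thesis by blast
qed

end

section \<open>Heights of rational numbers and word lengths of single entries\<close>

lemma rat_signed_fraction:
  fixes x :: rat
  obtains e :: rat and a b :: nat where "e = 1 \<or> e = -1" "b > 0" "coprime a b"
    "x = e * of_nat a / of_nat b" "a = 0 \<longleftrightarrow> x = 0"
proof -
  obtain c d where q: "quotient_of x = (c, d)" by fastforce
  have d: "d > 0" and cop: "coprime c d" and x: "x = of_int c / of_int d"
    using q quotient_of_denom_pos quotient_of_coprime quotient_of_div by blast+
  have "coprime (nat \<bar>c\<bar>) (nat d)" using cop d by (simp add: coprime_int_iff[symmetric])
  moreover have "x = (if c \<ge> 0 then 1 else -1) * of_nat (nat \<bar>c\<bar>) / of_nat (nat d)"
    using x d by (simp add: of_nat_nat)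
  ultimately show thesis using d x by (intro that[of "if c \<ge> 0 then 1 else -1" "nat d" "nat \<bar>c\<bar>"]) auto
qed

context
  fixes e :: rat and a b :: nat and x :: rat
  assumes e: "e = 1 \<or> e = -1" and b: "b > 0" and a: "a > 0" and cop: "coprime a b"
    and x: "x = e * of_nat a / of_nat b"
begin

lemma padic_abs_signed_fraction:
  assumes q: "prime q"
  shows "padic_abs q x = real q ^ multiplicity q b / real q ^ multiplicity q a"
proof -
  have "padic_abs q x = padic_abs q (of_nat a * (1 / of_nat b))"
    using e padic_abs_minus[OF q] by (auto simp: x)
  also have "\<dots> = padic_abs q (of_nat a) * (1 / padic_abs q (of_nat b))"
    unfolding padic_abs_mult[OF q] padic_abs_inverse[OF q] ..
  finally show ?thesis using q a b by (simp add: padic_abs_of_nat)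
qed

lemma padic_abs_prime_dvd_denominator:
  assumes q: "prime q" "q dvd b"
  shows "padic_abs q x = real q ^ multiplicity q b" "padic_abs q x > 1"
proof -
  have "\<not> q dvd a" using q cop by (meson coprime_common_divisor not_prime_unit)
  then show eq: "padic_abs q x = real q ^ multiplicity q b"
    by (simp add: padic_abs_signed_fraction[OF q(1)] not_dvd_imp_multiplicity_0)
  have "multiplicity q b > 0" using q b by (simp add: prime_multiplicity_gt_zero_iff)
  then show "padic_abs q x > 1" unfolding eq using prime_gt_1_nat[OF q(1)] by simp
qed

lemma padic_abs_prime_dvd_numerator:
  assumes q: "prime q" "q dvd a"
  shows "padic_abs q x < 1"
proof -
  have "\<not> q dvd b" using q cop by (meson coprime_common_divisor not_prime_unit)
  moreover have "multiplicity q a > 0" using q a by (simp add: prime_multiplicity_gt_zero_iff)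
  ultimately show ?thesis
    using prime_gt_1_nat[OF q(1)]
    by (simp add: padic_abs_signed_fraction[OF q(1)] not_dvd_imp_multiplicity_0)
qed

text \<open>The right-hand side is the logarithmic height of \<open>x\<close>. Since the fraction is
  reduced, the part of \<open>b\<close> at a prime \<open>q\<close> is exactly the absolute value of
  \<open>x\<close> at \<open>q\<close>, so the finite places recover
  \<open>ln (real b)\<close>.\<close>

lemma ln_numerator_denominator_le:
  assumes P: "finite P" "prime_factors b \<subseteq> P"
  shows "ln (real b) \<le> (\<Sum>v\<in>places_over P. max (ln (place_abs v x)) 0)"
    and "ln (real a) \<le> (\<Sum>v\<in>places_over P. max (ln (place_abs v x)) 0)"
proof -
  have "ln (real b) = ln (\<Prod>q\<in>prime_factors b. real (q ^ multiplicity q b))"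
    using prime_factorization_nat[OF b] by (metis of_nat_prod)
  also have "\<dots> = (\<Sum>q\<in>prime_factors b. ln (real q ^ multiplicity q b))"
    by (subst ln_prod) (auto intro: prime_gt_0_nat in_prime_factors_imp_prime)
  also have "\<dots> \<le> (\<Sum>q\<in>prime_factors b. max (ln (place_abs (Finite_Place q) x)) 0)"
    by (intro sum_mono) (auto simp: place_abs_def padic_abs_prime_dvd_denominator(1)
        [OF in_prime_factors_imp_prime in_prime_factors_imp_dvd])
  also have "\<dots> \<le> (\<Sum>q\<in>P. max (ln (place_abs (Finite_Place q) x)) 0)"
    using P by (intro sum_mono2) auto
  finally have lb: "ln (real b) \<le> \<dots>" .
  have "\<bar>real_of_rat x\<bar> = real a / real b"
    using e by (auto simp: x of_rat_divide of_rat_minus)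
  \<comment> \<open>The numerator is the real absolute value of \<open>x\<close> times the
    denominator, so the infinite place supplies the missing term.\<close>
  then have "ln (real a) = ln (place_abs Infinite_Place x) + ln (real b)"
    using a b by (simp add: place_abs_def ln_div)
  with lb show "ln (real b) \<le> (\<Sum>v\<in>places_over P. max (ln (place_abs v x)) 0)"
    and "ln (real a) \<le> (\<Sum>v\<in>places_over P. max (ln (place_abs v x)) 0)"
    unfolding sum_places_over[OF P(1)] by linarith+
qed

end

text \<open>Integrality outside \<open>P\<close> confines the primes of the denominator to
  \<open>P\<close>. On the diagonal, the absolute value 1 outside \<open>P\<close> does the same for
  the numerator.\<close>

lemma word_ball_theta_entry:
  assumes P: "finite P" "0 \<notin> P" and p: "p \<in> P" "p \<ge> 2" and rs: "r \<le> s" "s < n"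
    and x: "\<And>q. prime q \<Longrightarrow> q \<notin> P \<Longrightarrow> padic_abs q x \<le> 1"
    and diag: "r = s \<Longrightarrow> x > 0 \<and> (\<forall>q. prime q \<longrightarrow> q \<notin> P \<longrightarrow> padic_abs q x = 1)"
    and h: "(\<Sum>v\<in>places_over P. max (ln (place_abs v x)) 0) \<le> h"
  shows "theta n r s x \<in> word_ball n P ((real p + 4) * (1 + h / ln 2))"
proof -
  have "0 \<le> (\<Sum>v\<in>places_over P. max (ln (place_abs v x)) 0)" by (intro sum_nonneg) simp
  then have h0: "0 \<le> h / ln 2" using h by simp
  show ?thesis
  proof (cases "x = 0")
    case True
    then have "theta n r s x = 1\<^sub>m n" using diag by (cases "r = s") auto
    then show ?thesis using one_word_ball[OF P(2)] h0 by simp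
  next
    case False
    obtain e :: rat and a b :: nat where fr: "e = 1 \<or> e = -1" "b > 0" "coprime a b"
        "x = e * of_nat a / of_nat b" "a = 0 \<longleftrightarrow> x = 0"
      by (rule rat_signed_fraction[of x])
    have a: "a > 0" using fr(5) False by simp
    have b: "prime_factors b \<subseteq> P"
    proof
      fix q assume "q \<in> prime_factors b"
      then have q: "prime q" "q dvd b"
        by (rule in_prime_factors_imp_prime, rule in_prime_factors_imp_dvd)
      have "\<not> padic_abs q x \<le> 1"
        using padic_abs_prime_dvd_denominator(2)[OF fr(1,2) a fr(3,4) q] by simp
      then show "q \<in> P" using x[OF q(1)] by blast
    qed
    have lb: "ln (real b) / ln 2 \<le> h / ln 2"
      by (rule divide_right_mono[OF order.trans[OF ln_numerator_denominator_le(1)[OF fr(1,2) a fr(3,4) P(1) b] h]])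
        simp
    have la: "ln (real a) / ln 2 \<le> h / ln 2"
      by (rule divide_right_mono[OF order.trans[OF ln_numerator_denominator_le(2)[OF fr(1,2) a fr(3,4) P(1) b] h]])
        simp
    have p0: "real p * (ln (real a) / ln 2) \<le> real p * (h / ln 2)"
      using la by (intro mult_left_mono) auto
    show ?thesis
    proof (cases "r = s")
      case True
      \<comment> \<open>Diagonal generators are positive, so the sign has to be excluded
        here.\<close>
      have e1: "e = 1" using diag[OF True] fr(1,4) by (auto simp: zero_less_divide_iff)
      have "prime_factors a \<subseteq> P"
      proof
        fix q assume "q \<in> prime_factors a"
        then have q: "prime q" "q dvd a"
          by (rule in_prime_factors_imp_prime, rule in_prime_factors_imp_dvd)
        have "padic_abs q x \<noteq> 1"
          using padic_abs_prime_dvd_numerator[OF fr(1,2) a fr(3,4) q] by simp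
        then show "q \<in> P" using diag[OF True] q(1) by blast
      qed
      then have "theta n s s x \<in> word_ball n P (ln (real a) / ln 2 + ln (real b) / ln 2)"
        using word_ball_theta_diag_fract[OF P(2) rs(2) a _ fr(2) b] fr(4) e1 by simp
      moreover have "ln (real a) / ln 2 + ln (real b) / ln 2 \<le> (real p + 4) * (1 + h / ln 2)"
      proof -
        have "2 * (h / ln 2) \<le> (real p + 4) * (1 + h / ln 2)"
          using h0 by (intro mult_mono) auto
        then show ?thesis using la lb by linarith
      qed
      ultimately show ?thesis using True word_ball_mono by auto
    next
      case False
      with rs have "theta n r s x \<in>
          word_ball n P ((real p + 2) * (1 + ln (real a) / ln 2) + 2 * (ln (real b) / ln 2))"
        unfolding fr(4) by (intro word_ball_theta_fract P p fr b) auto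
      moreover have "(real p + 2) * (1 + ln (real a) / ln 2) + 2 * (ln (real b) / ln 2) \<le>
          (real p + 4) * (1 + h / ln 2)"
      proof -
        \<comment> \<open>\<open>H\<close> bounds the logarithms \<open>A\<close> and
          \<open>B\<close> of numerator and denominator, and the two conjugations turn
          \<open>p + 2\<close> into \<open>p + 4\<close>.\<close>
        have "(real p + 2) * (1 + A) + 2 * B \<le> (real p + 4) * (1 + H)"
          if "real p * A \<le> real p * H" "A \<le> H" "B \<le> H" for A B H :: real
          using that by (simp add: algebra_simps)
        then show ?thesis using p0 la lb by blast
      qed
      ultimately show ?thesis by (rule word_ball_mono)
    qed
  qed
qed

text \<open>Every matrix entry is bounded by the operator norm at each place, so the height of every
  entry is at most the adelic length of \<open>f\<close>.\<close>

lemma word_length_le_adelic_length: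
  assumes P: "finite P" "\<And>p. p \<in> P \<Longrightarrow> prime p" "P \<noteq> {}"
  shows "\<exists>C\<ge>0. \<forall>f\<in>FG n P. of_nat (word_length n P f) \<le> ennreal C * (1 + adelic_length n f)"
proof -
  \<comment> \<open>Nonemptiness of \<open>P\<close> provides the base of the Horner scheme.\<close>
  obtain p where p: "p \<in> P" using P by blast
  have p2: "p \<ge> 2" using P(2)[OF p] prime_ge_2_nat by blast
  have P0: "0 \<notin> P" using P(2) by fastforce
  \<comment> \<open>There are at most \<open>n * n\<close> entries, each costing
    \<open>(p + 4) * (1 + h / ln 2)\<close>; the last factor turns \<open>1 + h / ln 2\<close> into
    a multiple of \<open>1 + h\<close>.\<close>
  define C where "C = real n * real n * (real p + 4) * (1 + 1 / ln 2)"
  have C: "C \<ge> 0" by (simp add: C_def)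
  have "of_nat (word_length n P f) \<le> ennreal C * (1 + adelic_length n f)" if f: "f \<in> FG n P" for f
  \<comment> \<open>An infinite adelic length makes the bound infinite only if \<open>C\<close> is
    positive, which fails for \<open>n = 0\<close>. There the only matrix is the identity, of word
    length 0.\<close>
  proof (cases "adelic_length n f = \<top> \<or> n = 0")
    case True
    have "word_length n P f = 0" if "n = 0"
    proof -
      have "f \<in> carrier_mat 0 0"
        using word_controlled_FG(1)[OF P(1,2) f] that by (simp add: word_controlled_def)
      then have "f = 1\<^sub>m 0" by auto
      then show ?thesis
        using that word_length_le[OF one_word_ball[OF P0, of 0 n]] by simp
    qed
    moreover have "C > 0" if "n \<noteq> 0"
      using that by (simp add: C_def add_pos_pos)
    ultimately show ?thesis using True
      by (cases "n = 0") (auto simp: ennreal_mult_top ennreal_eq_0_iff)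
  next
    case False
    define h where "h = enn2real (adelic_length n f)"
    have h: "adelic_length n f = ennreal h" using False by (simp add: h_def top.not_eq_extremum)
    have h0: "h \<ge> 0" by (simp add: h_def)
    have wc: "word_controlled n P (word_length n P f) f" by (rule word_controlled_FG(1)[OF P(1,2) f])
    then have fc: "f \<in> carrier_mat n n" by (simp add: word_controlled_def)
    have hx: "(\<Sum>v\<in>places_over P. max (ln (place_abs v (f $$ (i, j)))) 0) \<le> h"
      if "i < n" "j < n" for i j
    proof -
      have "ennreal (\<Sum>v\<in>places_over P. max (ln (place_abs v (f $$ (i, j)))) 0) =
          (\<Sum>v\<in>places_over P. ln_plus (ennreal (place_abs v (f $$ (i, j)))))"
        by (simp add: ln_plus_ennreal place_abs_nonneg sum_ennreal del: ennreal_max_0')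
      also have "\<dots> \<le> (\<Sum>v\<in>places_over P. ln_plus (op_norm n v f) + ln_plus (op_norm n v (inv\<^bsub>GL n\<^esub> f)))"
        using that P(2) fc
        by (intro sum_mono order.trans[OF ln_plus_mono[OF place_abs_le_op_norm]])
          (auto simp: places_over_def places_def simp del: op_norm.simps)
      also have "\<dots> = ennreal h" using adelic_length_FG[OF P(1,2) f] h by simp
      finally show ?thesis using h0 by (simp add: ennreal_le_iff)
    qed
    have "f \<in> word_ball n P (real n * real n * ((real p + 4) * (1 + h / ln 2)))"
    proof (rule upper_triangular_word_ball[OF P0 fc])
      show "0 \<le> (real p + 4) * (1 + h / ln 2)" using h0 by simp
      show "f $$ (i, j) = 0" if "j < i" "i < n" for i j
        using wc that by (simp add: word_controlled_def)
      show "theta n r k (f $$ (r, k)) \<in> word_ball n P ((real p + 4) * (1 + h / ln 2))"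
        if rk: "r \<le> k" "k < n" for r k
      proof (rule word_ball_theta_entry[OF P(1) P0 p p2 rk])
        show "padic_abs q (f $$ (r, k)) \<le> 1" if "prime q" "q \<notin> P" for q
        proof -
          have "padic_abs q (f $$ (r, k)) \<le> word_bound P (Finite_Place q) ^ word_length n P f"
            using wc that rk by (simp add: word_controlled_def)
          then show ?thesis using that by (simp add: word_bound_def)
        qed
        show "f $$ (r, k) > 0 \<and> (\<forall>q. prime q \<longrightarrow> q \<notin> P \<longrightarrow> padic_abs q (f $$ (r, k)) = 1)" if "r = k"
          using wc that rk by (simp add: word_controlled_def)
      qed (use hx rk in simp)
    qed
    then have "real (word_length n P f) \<le> real n * real n * ((real p + 4) * (1 + h / ln 2))"
      by (rule word_length_le)
    also have "\<dots> = real n * real n * (real p + 4) * (1 + h / ln 2)" by simp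
    also have "\<dots> \<le> real n * real n * (real p + 4) * ((1 + 1 / ln 2) * (1 + h))"
      using h0 by (intro mult_left_mono) (auto simp: field_simps)
    also have "\<dots> = C * (1 + h)" by (simp add: C_def)
    finally have "ennreal (real (word_length n P f)) \<le> ennreal (C * (1 + h))" by (rule ennreal_leI)
    then show ?thesis
      using C h0 by (simp add: h ennreal_mult ennreal_plus ennreal_of_nat_eq_real_of_nat)
  qed
  with C show ?thesis by blast
qed

text \<open>Total mass 1 makes the integral of the bound equal to the same affine expression in the
  integral of \<open>v\<close>.\<close>

lemma (in prob_space) nn_integral_finite_affine_bound:
  assumes "v \<in> borel_measurable M"
    and "\<And>x. x \<in> space M \<Longrightarrow> u x \<le> ennreal C * (1 + v x)" and "(\<integral>\<^sup>+ x. v x \<partial>M) < \<infinity>"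
  shows "(\<integral>\<^sup>+ x. u x \<partial>M) < \<infinity>"
proof -
  have "(\<integral>\<^sup>+ x. u x \<partial>M) \<le> (\<integral>\<^sup>+ x. ennreal C * (1 + v x) \<partial>M)"
    by (intro nn_integral_mono assms)
  also have "\<dots> = ennreal C * (1 + (\<integral>\<^sup>+ x. v x \<partial>M))"
    using assms(1) by (simp add: nn_integral_cmult nn_integral_add emeasure_space_1)
  also have "\<dots> < \<infinity>"
    using assms(3) by (simp add: ennreal_mult_less_top)
  finally show ?thesis .
qed

theorem corollary4p3p2:
  fixes n :: nat and P :: "nat set" and \<mu> :: "rat mat measure"
  assumes "P \<noteq> {}" and "finite P" and "\<And>p. p \<in> P \<Longrightarrow> prime p"
    and "prob_space \<mu>" and "space \<mu> = FG n P" and "sets \<mu> = Pow (FG n P)"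
  shows "(\<integral>\<^sup>+ f. of_nat (word_length n P f) \<partial>\<mu>) < \<infinity> \<longleftrightarrow>
         (\<integral>\<^sup>+ f. adelic_length n f \<partial>\<mu>) < \<infinity>"
proof -
  interpret prob_space \<mu> by fact
  \<comment> \<open>Every subset of the group is measurable, hence so is every function on
    it.\<close>
  have meas: "g \<in> borel_measurable \<mu>" for g :: "rat mat \<Rightarrow> ennreal"
    using assms(5,6) by (auto simp: measurable_def)
  obtain C D where "\<And>f. f \<in> FG n P \<Longrightarrow> of_nat (word_length n P f) \<le> ennreal C * (1 + adelic_length n f)"
    "\<And>f. f \<in> FG n P \<Longrightarrow> adelic_length n f \<le> ennreal D * (1 + of_nat (word_length n P f))"
    using word_length_le_adelic_length[OF assms(2,3,1), of n]
      adelic_length_le_word_length[OF assms(2,3), of n] by blast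
  then show ?thesis
    using nn_integral_finite_affine_bound[OF meas] assms(5) by metis
qed

end
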